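(* Let $M,N\ge3$ be integers and $p_0,p_1,p_2,p_3,p_4\in[0,1]$. Fix integers $r,s\ge1$. Assume that $\boldsymbol P^\circ:=(\boldsymbol P_A^\circ)^r(\boldsymbol P_B^\circ)^s$, as well as all cyclic permutations of the product $(\boldsymbol P_A^\circ)^r(\boldsymbol P_B^\circ)^s$, are ergodic, and let the row vector $\boldsymbol\pi^\circ$ be the unique stationary distribution of $\boldsymbol P^\circ$. Let $\boldsymbol Z^\circ:=(\boldsymbol I-(\boldsymbol P^\circ-\boldsymbol 1\boldsymbol\pi^\circ))^{-1}$ and let $$\mu_{[r,s]}^\circ:=\frac{1}{r+s}\sum_{v=0}^{s-1}\boldsymbol\pi^\circ(\boldsymbol P_A^\circ)^r(\boldsymbol P_B^\circ)^v\dot{\boldsymbol P}_B^\circ\boldsymbol 1$$ and $$\begin{aligned}(\sigma_{[r,s]}^\circ)^2:={}&1-\frac{1}{r+s}\sum_{v=0}^{s-1}\big(\boldsymbol\pi^\circ(\boldsymbol P_A^\circ)^r(\boldsymbol P_B^\circ)^v\dot{\boldsymbol P}_B^\circ\boldsymbol 1\big)^2\\ &+\frac{2}{r+s}\bigg[\sum_{u=0}^{r-1}\sum_{v=0}^{s-1}\boldsymbol\pi^\circ(\boldsymbol P_A^\circ)^u\dot{\boldsymbol P}_A^\circ\big((\boldsymbol P_A^\circ)^{r-u-1}(\boldsymbol P_B^\circ)^v-\boldsymbol 1\boldsymbol\pi^\circ(\boldsymbol P_A^\circ)^r(\boldsymbol P_B^\circ)^v\big)\dot{\boldsymbol P}_B^\circ\boldsymbol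 1\\ &\quad+\sum_{0\le u<v\le s-1}\boldsymbol\pi^\circ(\boldsymbol P_A^\circ)^r(\boldsymbol P_B^\circ)^u\dot{\boldsymbol P}_B^\circ\big((\boldsymbol P_B^\circ)^{v-u-1}-\boldsymbol 1\boldsymbol\pi^\circ(\boldsymbol P_A^\circ)^r(\boldsymbol P_B^\circ)^v\big)\dot{\boldsymbol P}_B^\circ\boldsymbol 1\\ &\quad+\sum_{u=0}^{r-1}\sum_{v=0}^{s-1}\boldsymbol\pi^\circ(\boldsymbol P_A^\circ)^u\dot{\boldsymbol P}_A^\circ(\boldsymbol P_A^\circ)^{r-u-1}(\boldsymbol P_B^\circ)^s(\boldsymbol Z^\circ-\boldsymbol 1\boldsymbol\pi^\circ)(\boldsymbol P_A^\circ)^r(\boldsymbol P_B^\circ)^v\dot{\boldsymbol P}_B^\circ\boldsymbol 1\\ &\quad+\sum_{u=0}^{s-1}\sum_{v=0}^{s-1}\boldsymbol\pi^\circ(\boldsymbol P_A^\circ)^r(\boldsymbol P_B^\circ)^u\dot{\boldsymbol P}_B^\circ(\boldsymbol P_B^\circ)^{s-u-1}(\boldsymbol Z^\circ-\boldsymbol 1\boldsymbol\pi^\circ)(\boldsymbol P_A^\circ)^r(\boldsymbol P_B^\circ)^v\dot{\boldsymbol P}_B^\circ\boldsymbol 1\bigg].\end{aligned}$$ Let $\{X_n^\circ\}_{n\ge0}$ be a temporally nonhomogeneous Markov chain in $\Sigma^\circ$ with one-step transition matrices $\boldsymbol P_A^\circ,\ldots,\boldsymbol P_A^\circ$ ($r$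 times), $\boldsymbol P_B^\circ,\ldots,\boldsymbol P_B^\circ$ ($s$ times), $\boldsymbol P_A^\circ,\ldots,\boldsymbol P_A^\circ$ ($r$ times), $\boldsymbol P_B^\circ,\ldots,\boldsymbol P_B^\circ$ ($s$ times), and so on, and let the initial distribution be arbitrary. For each $n\ge1$, define $\xi_n:=w^\circ(X_{n-1}^\circ,X_n^\circ)$ and $S_n:=\xi_1+\cdots+\xi_n$. Then $\lim_{n\to\infty}n^{-1}S_n=\mu_{[r,s]}^\circ$ almost surely and, if $(\sigma_{[r,s]}^\circ)^2>0$, then $$\frac{S_n-n\mu_{[r,s]}^\circ}{\sqrt{n(\sigma_{[r,s]}^\circ)^2}}\to N(0,1)\quad\text{in distribution as }n\to\infty.$$
   Context: Setting. $M,N\ge3$; $\Sigma:=\{0,1\}^{MN}$ is the set of $M\times N$ arrays $\boldsymbol x=(x_{i,j})$ of 0s and 1s. Indices are periodic: first subscripts $M+1$ and $0$ mean $1$ and $M$; second subscripts $N+1$ and $0$ mean $1$ and $N$. Put $m_{i,j}(\boldsymbol x):=x_{i+1,j}+x_{i-1,j}+x_{i,j+1}+x_{i,j-1}$, and let $\boldsymbol x^{i,j}$ be $\boldsymbol x$ with the entry at $(i,j)$ changed. Let $q_m:=1-p_m$. Augmented transition matrices. $\Sigma^\circ:=\Sigma\times\{-1,1\}$. The matrix $\boldsymbol P_B^\circ$ on $\Sigma^\circ$ is given, for every $(\boldsymbol x,s)\in\Sigma^\circ$ and all $i,j$, by - $P_B^\circ((\boldsymbol x,s),(\boldsymbol x^{i,j},1)):=(MN)^{-1}p_{m_{i,j}(\boldsymbol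 x)}$ if $x_{i,j}=0$, and $0$ if $x_{i,j}=1$; - $P_B^\circ((\boldsymbol x,s),(\boldsymbol x^{i,j},-1)):=0$ if $x_{i,j}=0$, and $(MN)^{-1}q_{m_{i,j}(\boldsymbol x)}$ if $x_{i,j}=1$; - $P_B^\circ((\boldsymbol x,s),(\boldsymbol x,1)):=(MN)^{-1}\sum_{i,j:\,x_{i,j}=1}p_{m_{i,j}(\boldsymbol x)}$; - $P_B^\circ((\boldsymbol x,s),(\boldsymbol x,-1)):=(MN)^{-1}\sum_{i,j:\,x_{i,j}=0}q_{m_{i,j}(\boldsymbol x)}$; all other entries are $0$ (empty sums are $0$). (In these formulas $s\in\{-1,1\}$ is the second component of a state, not the integer $s$ of the claim.) $\boldsymbol P_A^\circ$ is $\boldsymbol P_B^\circ$ with $p_0=p_1=p_2=p_3=p_4=1/2$. The states $(\boldsymbol 0,1)$ and $(\boldsymbol 1,-1)$ (all-0s array with second component $1$; all-1s array with second component $-1$) are inaccessible; they are kept in the state space, and "ergodic" means irreducible and aperiodic once these two states are excluded. Payoff. $w^\circ((\boldsymbol x,s),(\boldsymbol x^{i,j},t))=t$ if $x_{i,j}=(1-t)/2$, and $w^\circ((\boldsymbol x,s),(\boldsymbol x,t))=t$, for all $(\boldsymbol x,s)\in\Sigma^\circ$, all $i,j$, and $t\in\{-1,1\}$; $w^\circ=0$ otherwise. $\boldsymbol W^\circ$ is the matrix with entries given by $w^\circ$; $\dot{\boldsymbol P}_A^\circ:=\boldsymbol P_A^\circ\circ\boldsymbol W^\circ$ and $\dot{\boldsymbol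 P}_B^\circ:=\boldsymbol P_B^\circ\circ\boldsymbol W^\circ$, where $\circ$ between matrices is the Hadamard (entrywise) product. $\boldsymbol 1$ is the column vector of 1s indexed by $\Sigma^\circ$. The cyclic permutations of $(\boldsymbol P_A^\circ)^r(\boldsymbol P_B^\circ)^s$ are the products obtained by cyclically permuting its $r+s$ factors. *)

theory Defs
  imports "HOL-Probability.Probability"
begin

section \<open>Matrices and chains on a finite index set\<close>

text \<open>The index set \<open>S\<close> is an arbitrary finite set of states, so a square matrix is a function of
  two states of which only the entries in \<open>S \<times> S\<close> matter.\<close>

context
  fixes S :: "'a set"
begin

definition idmat :: "'a \<Rightarrow> 'a \<Rightarrow> real"
  where "idmat = (\<lambda>x y. if x = y then 1 else 0)"

definition mmul :: "('a \<Rightarrow> 'a \<Rightarrow> real) \<Rightarrow> ('a \<Rightarrow> 'a \<Rightarrow> real) \<Rightarrow> 'a \<Rightarrow> 'a \<Rightarrow> real"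
    (infixl "\<^bold>*" 70)
  where "A \<^bold>* B = (\<lambda>x y. \<Sum>z\<in>S. A x z * B z y)"

primrec mpow :: "('a \<Rightarrow> 'a \<Rightarrow> real) \<Rightarrow> nat \<Rightarrow> 'a \<Rightarrow> 'a \<Rightarrow> real"  (infixr "\<^bold>^" 80)
  where
    "A \<^bold>^ 0 = idmat"
  | "A \<^bold>^ Suc k = A \<^bold>* A \<^bold>^ k"

definition mprod :: "('a \<Rightarrow> 'a \<Rightarrow> real) list \<Rightarrow> 'a \<Rightarrow> 'a \<Rightarrow> real"
  where "mprod As = foldr (\<^bold>*) As idmat"

definition minv :: "('a \<Rightarrow> 'a \<Rightarrow> real) \<Rightarrow> 'a \<Rightarrow> 'a \<Rightarrow> real"
  where "minv A = (SOME B. \<forall>x\<in>S. \<forall>y\<in>S. (A \<^bold>* B) x y = idmat x y \<and> (B \<^bold>* A) x y = idmat x y)"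

definition hadamard :: "('a \<Rightarrow> 'a \<Rightarrow> real) \<Rightarrow> ('a \<Rightarrow> 'a \<Rightarrow> real) \<Rightarrow> 'a \<Rightarrow> 'a \<Rightarrow> real"
  where "hadamard A B = (\<lambda>x y. A x y * B x y)"

text \<open>The matrix \<open>\<one>\<pi>\<close> (column of ones times the row vector \<open>\<pi>\<close>), and the scalar \<open>\<pi>A\<one>\<close>.\<close>

definition one_row :: "('a \<Rightarrow> real) \<Rightarrow> 'a \<Rightarrow> 'a \<Rightarrow> real"
  where "one_row \<pi> = (\<lambda>x y. \<pi> y)"

definition row_mat_one :: "('a \<Rightarrow> real) \<Rightarrow> ('a \<Rightarrow> 'a \<Rightarrow> real) \<Rightarrow> real"
  where "row_mat_one \<pi> A = (\<Sum>x\<in>S. \<Sum>y\<in>S. \<pi> x * A x y)"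

definition irreducible_mat :: "('a \<Rightarrow> 'a \<Rightarrow> real) \<Rightarrow> bool"
  where "irreducible_mat P \<longleftrightarrow> (\<forall>x\<in>S. \<forall>y\<in>S. \<exists>n. (P \<^bold>^ n) x y > 0)"

definition aperiodic_mat :: "('a \<Rightarrow> 'a \<Rightarrow> real) \<Rightarrow> bool"
  where "aperiodic_mat P \<longleftrightarrow> (\<forall>x\<in>S. Gcd {n. n \<ge> 1 \<and> (P \<^bold>^ n) x x > 0} = 1)"

definition ergodic_mat :: "('a \<Rightarrow> 'a \<Rightarrow> real) \<Rightarrow> bool"
  where "ergodic_mat P \<longleftrightarrow> irreducible_mat P \<and> aperiodic_mat P"

definition stationary_dist :: "('a \<Rightarrow> 'a \<Rightarrow> real) \<Rightarrow> ('a \<Rightarrow> real) \<Rightarrow> bool"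
  where "stationary_dist P \<pi> \<longleftrightarrow>
    (\<forall>x\<in>S. \<pi> x \<ge> 0) \<and> (\<Sum>x\<in>S. \<pi> x) = 1 \<and> (\<forall>y\<in>S. (\<Sum>x\<in>S. \<pi> x * P x y) = \<pi> y)"

text \<open>\<open>Q n\<close> governs the step from time \<open>n\<close> to time \<open>n + 1\<close>.\<close>

definition markov_chain ::
    "'w measure \<Rightarrow> (nat \<Rightarrow> 'a \<Rightarrow> 'a \<Rightarrow> real) \<Rightarrow> (nat \<Rightarrow> 'w \<Rightarrow> 'a) \<Rightarrow> bool"
  where "markov_chain \<Omega> Q X \<longleftrightarrow>
    prob_space \<Omega> \<and>
    (\<forall>n. X n \<in> measurable \<Omega> (count_space S)) \<and>
    (\<forall>n x. \<forall>y\<in>S.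
      \<P>(\<omega> in \<Omega>. \<forall>k\<le>n. X k \<omega> = x k) > 0 \<longrightarrow>
      \<P>(\<omega> in \<Omega>. X (Suc n) \<omega> = y \<bar> \<forall>k\<le>n. X k \<omega> = x k) = Q n (x n) y)"

text \<open>Mean and variance parameters of the periodic pattern \<open>A\<^sup>r B\<^sup>s\<close> with payoff matrix \<open>W\<close>.  They
  are meant for payoffs \<open>\<plusminus>1\<close> and a fair game \<open>A\<close> (every row of \<open>A \<circ> W\<close> sums to 0 on \<open>S\<close>): this is why
  the second moments add up to the leading 1 of the variance and why no means of \<open>A\<close> occur.\<close>

definition pattern_mean ::
    "('a \<Rightarrow> 'a \<Rightarrow> real) \<Rightarrow> ('a \<Rightarrow> 'a \<Rightarrow> real) \<Rightarrow> ('a \<Rightarrow> 'a \<Rightarrow> real) \<Rightarrow> ('a \<Rightarrow> real) \<Rightarrow> nat \<Rightarrow> nat \<Rightarrow> real"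
  where "pattern_mean A B W \<pi> r s =
    (let B' = hadamard B W
     in 1 / real (r + s) * (\<Sum>v<s. row_mat_one \<pi> (A \<^bold>^ r \<^bold>* B \<^bold>^ v \<^bold>* B')))"

definition pattern_variance ::
    "('a \<Rightarrow> 'a \<Rightarrow> real) \<Rightarrow> ('a \<Rightarrow> 'a \<Rightarrow> real) \<Rightarrow> ('a \<Rightarrow> 'a \<Rightarrow> real) \<Rightarrow> ('a \<Rightarrow> real) \<Rightarrow> nat \<Rightarrow> nat \<Rightarrow> real"
  where "pattern_variance A B W \<pi> r s =
    (let A' = hadamard A W;
         B' = hadamard B W;
         E = one_row \<pi>;
         P = A \<^bold>^ r \<^bold>* B \<^bold>^ s;
         Z = minv (idmat - (P - E))
     in 1 - 1 / real (r + s) * (\<Sum>v<s. (row_mat_one \<pi> (A \<^bold>^ r \<^bold>* B \<^bold>^ v \<^bold>* B'))\<^sup>2)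
        + 2 / real (r + s) *
          ((\<Sum>u<r. \<Sum>v<s. row_mat_one \<pi>
              (A \<^bold>^ u \<^bold>* A' \<^bold>* (A \<^bold>^ (r - u - 1) \<^bold>* B \<^bold>^ v - E \<^bold>* A \<^bold>^ r \<^bold>* B \<^bold>^ v) \<^bold>* B'))
         + (\<Sum>v<s. \<Sum>u<v. row_mat_one \<pi>
              (A \<^bold>^ r \<^bold>* B \<^bold>^ u \<^bold>* B' \<^bold>* (B \<^bold>^ (v - u - 1) - E \<^bold>* A \<^bold>^ r \<^bold>* B \<^bold>^ v) \<^bold>* B'))
         + (\<Sum>u<r. \<Sum>v<s. row_mat_one \<pi>
              (A \<^bold>^ u \<^bold>* A' \<^bold>* A \<^bold>^ (r - u - 1) \<^bold>* B \<^bold>^ s \<^bold>* (Z - E) \<^bold>* A \<^bold>^ r \<^bold>* B \<^bold>^ v \<^bold>* B'))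
         + (\<Sum>u<s. \<Sum>v<s. row_mat_one \<pi>
              (A \<^bold>^ r \<^bold>* B \<^bold>^ u \<^bold>* B' \<^bold>* B \<^bold>^ (s - u - 1) \<^bold>* (Z - E) \<^bold>* A \<^bold>^ r \<^bold>* B \<^bold>^ v \<^bold>* B'))))"

end


section \<open>The spatial game on the torus\<close>

type_synonym array = "nat \<times> nat \<Rightarrow> nat"
type_synonym state = "array \<times> int"

definition grid :: "nat \<Rightarrow> nat \<Rightarrow> (nat \<times> nat) set"
  where "grid M N = {1..M} \<times> {1..N}"

definition arrays :: "nat \<Rightarrow> nat \<Rightarrow> array set"
  where "arrays M N = grid M N \<rightarrow>\<^sub>E {0, 1}"

definition states :: "nat \<Rightarrow> nat \<Rightarrow> state set"
  where "states M N = arrays M N \<times> {-1, 1}"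

definition const_array :: "nat \<Rightarrow> nat \<Rightarrow> nat \<Rightarrow> array"
  where "const_array M N c = (\<lambda>ij\<in>grid M N. c)"

text \<open>The two removed states cannot be entered: reaching \<open>(x, 1)\<close> requires an entry 1 in \<open>x\<close>, and
  reaching \<open>(x, -1)\<close> an entry 0.  They remain in \<open>states\<close>; ergodicity is asked of the matrix
  restricted to the other states.\<close>

definition accessible :: "nat \<Rightarrow> nat \<Rightarrow> state set"
  where "accessible M N = states M N - {(const_array M N 0, 1), (const_array M N 1, -1)}"

definition cyc_suc :: "nat \<Rightarrow> nat \<Rightarrow> nat"
  where "cyc_suc L i = (if i = L then 1 else i + 1)"

definition cyc_pred :: "nat \<Rightarrow> nat \<Rightarrow> nat"
  where "cyc_pred L i = (if i = 1 then L else i - 1)"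

definition nbr_sum :: "nat \<Rightarrow> nat \<Rightarrow> array \<Rightarrow> nat \<times> nat \<Rightarrow> nat"
  where "nbr_sum M N x = (\<lambda>(i, j).
    x (cyc_suc M i, j) + x (cyc_pred M i, j) + x (i, cyc_suc N j) + x (i, cyc_pred N j))"

definition flip :: "array \<Rightarrow> nat \<times> nat \<Rightarrow> array"
  where "flip x ij = x(ij := 1 - x ij)"

text \<open>At most one site \<open>ij\<close> satisfies \<open>y = flip x ij\<close>, so the sum in the last branch has at most
  one term; the lemmas below give the entries one by one.\<close>

definition P_B :: "nat \<Rightarrow> nat \<Rightarrow> (nat \<Rightarrow> real) \<Rightarrow> state \<Rightarrow> state \<Rightarrow> real"
  where "P_B M N p = (\<lambda>(x, _) (y, t). 1 / real (M * N) *
    (if y = x then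
       if t = 1 then \<Sum>ij | ij \<in> grid M N \<and> x ij = 1. p (nbr_sum M N x ij)
       else \<Sum>ij | ij \<in> grid M N \<and> x ij = 0. 1 - p (nbr_sum M N x ij)
     else
       \<Sum>ij | ij \<in> grid M N \<and> y = flip x ij.
         if x ij = 0 \<and> t = 1 then p (nbr_sum M N x ij)
         else if x ij = 1 \<and> t = -1 then 1 - p (nbr_sum M N x ij)
         else 0))"

definition P_A :: "nat \<Rightarrow> nat \<Rightarrow> state \<Rightarrow> state \<Rightarrow> real"
  where "P_A M N = P_B M N (\<lambda>_. 1 / 2)"

definition payoff :: "nat \<Rightarrow> nat \<Rightarrow> state \<Rightarrow> state \<Rightarrow> real"
  where "payoff M N = (\<lambda>(x, _) (y, t).
    if y = x \<or> (\<exists>ij\<in>grid M N. y = flip x ij \<and> real (x ij) = (1 - real_of_int t) / 2)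
    then real_of_int t else 0)"

lemma flip_ne: "flip x ij \<noteq> x"
proof
  assume "flip x ij = x"
  then have "flip x ij ij = x ij" by simp
  then show False by (simp add: flip_def) presburger
qed

lemma flip_eq_flip_iff:
  "flip x ij = flip x kl \<longleftrightarrow> ij = kl"
proof
  assume "flip x ij = flip x kl"
  then have "flip x ij ij = flip x kl ij" by simp
  then show "ij = kl"
    by (simp add: flip_def split: if_splits) presburger
qed simp

lemma P_B_flip:
  assumes "ij \<in> grid M N"
  shows "P_B M N p (x, s) (flip x ij, 1) =
           (if x ij = 0 then 1 / real (M * N) * p (nbr_sum M N x ij) else 0)"
    and "P_B M N p (x, s) (flip x ij, -1) =
           (if x ij = 1 then 1 / real (M * N) * (1 - p (nbr_sum M N x ij)) else 0)"
proof -
  have "{kl. kl \<in> grid M N \<and> flip x ij = flip x kl} = {ij}"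
    using assms by (auto simp: flip_eq_flip_iff)
  then show "P_B M N p (x, s) (flip x ij, 1) =
           (if x ij = 0 then 1 / real (M * N) * p (nbr_sum M N x ij) else 0)"
    and "P_B M N p (x, s) (flip x ij, -1) =
           (if x ij = 1 then 1 / real (M * N) * (1 - p (nbr_sum M N x ij)) else 0)"
    by (simp_all add: P_B_def flip_ne)
qed

lemma P_B_stay:
  "P_B M N p (x, s) (x, 1) =
     1 / real (M * N) * (\<Sum>ij | ij \<in> grid M N \<and> x ij = 1. p (nbr_sum M N x ij))"
  "P_B M N p (x, s) (x, -1) =
     1 / real (M * N) * (\<Sum>ij | ij \<in> grid M N \<and> x ij = 0. 1 - p (nbr_sum M N x ij))"
  by (simp_all add: P_B_def)

lemma P_B_other:
  assumes "y \<noteq> x" and "\<And>ij. ij \<in> grid M N \<Longrightarrow> y \<noteq> flip x ij"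
  shows "P_B M N p (x, s) (y, t) = 0"
proof -
  have empty: "{ij. ij \<in> grid M N \<and> y = flip x ij} = {}"
    using assms(2) by blast
  then show ?thesis
    using assms(1) by (simp only: P_B_def prod.case empty sum.empty if_False mult_zero_right)
qed

end

theory Submission
  imports Defs "Jordan_Normal_Form.Determinant" "HOL-Library.Discrete_Functions"
begin

text \<open>Centre the payoff at time \<open>k\<close> by its stationary mean and solve the Poisson equation
  \<open>h\<^sub>k = f\<^sub>k - \<mu>\<^sub>k + Q\<^sub>k h\<^sub>k\<^sub>+\<^sub>1\<close> for the one-step means \<open>f\<^sub>k\<close>, periodically in \<open>k\<close>; over one period this is
  an equation for \<open>P\<close>, solved by the fundamental matrix \<open>Z\<close>.  Up to a bounded error the centred
  payoff sum is then a martingale with bounded increments, which gives the law of large numbers by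
  Chebyshev's inequality along squares.  A second Poisson equation, for the conditional variances of
  the martingale, replaces them by constants in the characteristic function and gives the central
  limit theorem by Levy's continuity theorem.  In the stationary variance of the martingale increments over
  a period the squares of the corrector \<open>h\<close> telescope, and expanding \<open>h\<close> in the covariances of payoff
  and corrector yields the four double sums of the variance formula.\<close>

section \<open>Matrices acting on functions\<close>

text \<open>The two inaccessible states stay in the index set, so
  \<open>idmat - (P - one_row \<pi>)\<close> has to be inverted on all of \<open>S\<close> although
  irreducibility holds only on \<open>C\<close>. Columns outside \<open>C\<close> vanish, so one
  step from any state lands in \<open>C\<close>, and harmonic functions are still constant on
  \<open>S\<close>. The initial law is arbitrary: stationary means at phase \<open>k\<close> are
  taken under \<open>\<pi>\<close> carried through \<open>k\<close> kernels, not under the law of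
  the chain, while the martingale property is a statement about conditional means from every single
  state. Conditioning is always a finite sum over histories. Solving through \<open>Z\<close> makes
  the corrector have stationary mean zero at every phase, which removes its products with the payoff
  means from the variance. The factor \<open>Z - one_row \<pi>\<close> of the variance is
  \<open>Z\<close> acting on a centred function, because \<open>Z\<close> fixes constants.\<close>

definition mv :: "'a set \<Rightarrow> ('a \<Rightarrow> 'a \<Rightarrow> real) \<Rightarrow> ('a \<Rightarrow> real) \<Rightarrow> 'a \<Rightarrow> real"
  where "mv S A f = (\<lambda>x. \<Sum>y\<in>S. A x y * f y)"

definition ip :: "'a set \<Rightarrow> ('a \<Rightarrow> real) \<Rightarrow> ('a \<Rightarrow> real) \<Rightarrow> real"
  where "ip S \<pi> f = (\<Sum>x\<in>S. \<pi> x * f x)"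

text \<open>A sum over \<open>S\<close> never sees values outside \<open>S\<close>, so agreement on
  \<open>S\<close> gives equality on the whole type; facts valid only on \<open>S\<close> can thus
  be rewritten under an operator.\<close>

lemma mv_cong: "(\<And>y. y \<in> S \<Longrightarrow> f y = g y) \<Longrightarrow> mv S A f = mv S A g"
  by (simp add: mv_def)

lemma ip_cong: "(\<And>y. y \<in> S \<Longrightarrow> f y = g y) \<Longrightarrow> ip S \<pi> f = ip S \<pi> g"
  by (simp add: ip_def)

lemma mv_add: "mv S A (\<lambda>x. f x + g x) = (\<lambda>x. mv S A f x + mv S A g x)"
  by (simp add: mv_def algebra_simps sum.distrib)

lemma mv_diff: "mv S A (\<lambda>x. f x - g x) = (\<lambda>x. mv S A f x - mv S A g x)"
  by (simp add: mv_def algebra_simps sum_subtractf)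

lemma mv_scale: "mv S A (\<lambda>x. c * f x) = (\<lambda>x. c * mv S A f x)"
  by (simp add: mv_def sum_distrib_left algebra_simps)

lemma mv_sum: "mv S A (\<lambda>x. \<Sum>i\<in>I. f i x) = (\<lambda>x. \<Sum>i\<in>I. mv S A (f i) x)"
  unfolding mv_def sum_distrib_left by (rule ext, subst sum.swap, rule refl)

lemma mv_zero [simp]: "mv S A (\<lambda>x. 0) = (\<lambda>x. 0)"
  by (simp add: mv_def)

lemma ip_add: "ip S \<pi> (\<lambda>x. f x + g x) = ip S \<pi> f + ip S \<pi> g"
  by (simp add: ip_def algebra_simps sum.distrib)

lemma ip_diff: "ip S \<pi> (\<lambda>x. f x - g x) = ip S \<pi> f - ip S \<pi> g"
  by (simp add: ip_def algebra_simps sum_subtractf)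

lemma ip_scale: "ip S \<pi> (\<lambda>x. c * f x) = c * ip S \<pi> f"
  by (simp add: ip_def sum_distrib_left algebra_simps)

lemma ip_sum: "ip S \<pi> (\<lambda>x. \<Sum>i\<in>I. f i x) = (\<Sum>i\<in>I. ip S \<pi> (f i))"
  unfolding ip_def sum_distrib_left by (subst sum.swap, rule refl)

text \<open>Turns the matrix products of the parameter formulas into compositions of operators, so
  that they expand without algebraic laws for \<open>mmul\<close>, whose unit \<open>idmat\<close>
  is neutral only on \<open>S\<close>.\<close>

lemma mv_mmul: "mv S (mmul S A B) f = mv S A (mv S B f)"
proof
  fix x
  have "mv S (mmul S A B) f x = (\<Sum>y\<in>S. \<Sum>z\<in>S. A x z * (B z y * f y))"
    by (simp add: mv_def mmul_def sum_distrib_right mult.assoc)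
  also have "\<dots> = mv S A (mv S B f) x"
    by (subst sum.swap) (simp add: mv_def sum_distrib_left)
  finally show "mv S (mmul S A B) f x = mv S A (mv S B f) x" .
qed

lemma mv_minus: "mv S (A - B) f = (\<lambda>x. mv S A f x - mv S B f x)"
  by (simp add: mv_def algebra_simps sum_subtractf)

lemma mv_idmat:
  assumes "finite S" "x \<in> S"
  shows "mv S idmat f x = f x"
  using assms by (simp add: mv_def idmat_def if_distrib[of "\<lambda>c. c * _"] cong: if_cong)

lemma mv_one_row: "mv S (one_row \<pi>) f = (\<lambda>_. ip S \<pi> f)"
  by (simp add: mv_def one_row_def ip_def)

lemma row_mat_one_eq: "row_mat_one S \<pi> A = ip S \<pi> (mv S A (\<lambda>_. 1))"
  by (simp add: row_mat_one_def ip_def mv_def sum_distrib_left)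

section \<open>Stochastic matrices, inverses and harmonic functions\<close>

definition stoch :: "'a set \<Rightarrow> ('a \<Rightarrow> 'a \<Rightarrow> real) \<Rightarrow> bool"
  where "stoch S A \<longleftrightarrow> (\<forall>x\<in>S. (\<forall>y\<in>S. A x y \<ge> 0) \<and> (\<Sum>y\<in>S. A x y) = 1)"

lemma stoch_nonneg: "stoch S A \<Longrightarrow> x \<in> S \<Longrightarrow> y \<in> S \<Longrightarrow> 0 \<le> A x y"
  by (simp add: stoch_def)

lemma stoch_mv_const: "stoch S A \<Longrightarrow> x \<in> S \<Longrightarrow> mv S A (\<lambda>_. c) x = c"
  by (simp add: stoch_def mv_def flip: sum_distrib_right)

lemma stoch_idmat: "finite S \<Longrightarrow> stoch S idmat"
  by (simp add: stoch_def idmat_def)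

lemma stoch_mmul:
  assumes "stoch S A" "stoch S B"
  shows "stoch S (mmul S A B)"
proof -
  have "(\<Sum>y\<in>S. mmul S A B x y) = 1" if x: "x \<in> S" for x
  proof -
    have "(\<Sum>y\<in>S. mmul S A B x y) = mv S (mmul S A B) (\<lambda>_. 1) x"
      by (simp add: mv_def)
    also have "\<dots> = mv S A (\<lambda>_. 1) x"
      unfolding mv_mmul using assms(2) by (intro fun_cong[OF mv_cong] stoch_mv_const)
    finally show ?thesis using assms(1) x by (simp add: stoch_mv_const)
  qed
  then show ?thesis
    using assms unfolding stoch_def mmul_def by (auto intro!: sum_nonneg mult_nonneg_nonneg)
qed

lemma stoch_mpow: "finite S \<Longrightarrow> stoch S A \<Longrightarrow> stoch S (mpow S A k)"
  by (induction k) (simp_all add: stoch_idmat stoch_mmul)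

text \<open>Transferred from matrices indexed by \<open>0..<n\<close> along an enumeration of \<open>S\<close>.\<close>

lemma ex_inverse_of_trivial_kernel:
  fixes A :: "'a \<Rightarrow> 'a \<Rightarrow> real"
  assumes fin: "finite S"
    and ker: "\<forall>f. (\<forall>x\<in>S. mv S A f x = 0) \<longrightarrow> (\<forall>x\<in>S. f x = 0)"
  shows "\<exists>B. \<forall>x\<in>S. \<forall>y\<in>S. mmul S A B x y = idmat x y \<and> mmul S B A x y = idmat x y"
proof -
  define n where "n = card S"
  obtain e where e: "bij_betw e {0..<n} S"
    using ex_bij_betw_nat_finite[OF fin] by (auto simp: n_def)
  define e' where "e' = the_inv_into {0..<n} e"
  have e'e: "e' (e i) = i" if "i < n" for i
    using e that by (auto simp: e'_def bij_betw_def the_inv_into_f_f)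
  have ee': "e (e' x) = x" and e'lt: "e' x < n" if "x \<in> S" for x
  proof -
    show "e (e' x) = x" unfolding e'_def by (rule f_the_inv_into_f_bij_betw[OF e that])
    have "e' x \<in> {0..<n}"
      unfolding e'_def using e that by (intro the_inv_into_into[OF _ _ order.refl]) (auto simp: bij_betw_def)
    then show "e' x < n" by simp
  qed
  have eS: "e i \<in> S" if "i < n" for i using e that by (auto simp: bij_betw_def)
  have sumS: "(\<Sum>x\<in>S. h x) = (\<Sum>i<n. h (e i))" for h :: "'a \<Rightarrow> real"
    using sum.reindex_bij_betw[OF e, of h] by (simp add: atLeast0LessThan)
  define C where "C = mat n n (\<lambda>(i, j). A (e i) (e j))"
  have C: "C \<in> carrier_mat n n" by (simp add: C_def)
  \<comment> \<open>A kernel vector of \<open>C\<close>, read back through \<open>e'\<close>, is a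
    function that \<open>A\<close> annihilates on \<open>S\<close>.\<close>
  have "det C \<noteq> 0"
  proof
    assume "det C = 0"
    then obtain v where v: "v \<in> carrier_vec n" "v \<noteq> 0\<^sub>v n" "C *\<^sub>v v = 0\<^sub>v n"
      using det_0_iff_vec_prod_zero_field[OF C] by blast
    define f where "f = (\<lambda>x. v $ e' x)"
    have "mv S A f x = 0" if x: "x \<in> S" for x
    proof -
      have "mv S A f x = (\<Sum>i<n. A x (e i) * v $ i)"
        by (simp add: mv_def sumS f_def e'e)
      also have "\<dots> = (C *\<^sub>v v) $ e' x"
        using v(1) x by (simp add: C_def scalar_prod_def e'lt ee' atLeast0LessThan)
      also have "\<dots> = 0" using v(3) e'lt[OF x] by simp
      finally show ?thesis .
    qed
    then have "f x = 0" if "x \<in> S" for x using spec[OF ker, of f] that by simp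
    then have "f (e i) = 0" if "i < n" for i using eS[OF that] by blast
    then have "v $ i = 0" if "i < n" for i
      using that e'e[OF that] unfolding f_def by metis
    then have "v = 0\<^sub>v n" using v(1) by (intro eq_vecI) auto
    then show False using v(2) by simp
  qed
  from det_non_zero_imp_unit[OF C this, of "()"]
  obtain D where D: "D \<in> carrier_mat n n" "D * C = 1\<^sub>m n" "C * D = 1\<^sub>m n"
    unfolding Units_def ring_mat_def by auto
  define B where "B = (\<lambda>x y. D $$ (e' x, e' y))"
  have "mmul S A B x y = idmat x y \<and> mmul S B A x y = idmat x y" if xy: "x \<in> S" "y \<in> S" for x y
  proof -
    have idm: "idmat x y = (1\<^sub>m n :: real mat) $$ (e' x, e' y)"
      using xy ee'[OF xy(1)] ee'[OF xy(2)] by (auto simp: idmat_def e'lt)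
    have "mmul S A B x y = (\<Sum>i<n. A x (e i) * D $$ (i, e' y))"
      by (simp add: mmul_def sumS B_def e'e)
    also have "\<dots> = (C * D) $$ (e' x, e' y)"
      using D(1) xy by (simp add: C_def scalar_prod_def e'lt ee' atLeast0LessThan)
    finally have AB: "mmul S A B x y = (C * D) $$ (e' x, e' y)" .
    have "mmul S B A x y = (\<Sum>i<n. D $$ (e' x, i) * A (e i) y)"
      by (simp add: mmul_def sumS B_def e'e)
    also have "\<dots> = (D * C) $$ (e' x, e' y)"
      using D(1) xy by (simp add: C_def scalar_prod_def e'lt ee' atLeast0LessThan)
    finally show ?thesis using AB D idm by simp
  qed
  then show ?thesis by blast
qed

text \<open>\<open>minv\<close> picks an inverse by choice and means something only when one exists;
  a trivial kernel guarantees that. The identities are stated at points of \<open>S\<close>, where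
  the choice is determined.\<close>

lemma minv_inverse:
  assumes "finite S"
    and "\<forall>f. (\<forall>x\<in>S. mv S A f x = 0) \<longrightarrow> (\<forall>x\<in>S. f x = 0)"
    and x: "x \<in> S"
  shows "mv S A (mv S (minv S A) f) x = f x" "mv S (minv S A) (mv S A f) x = f x"
proof -
  have *: "\<forall>x\<in>S. \<forall>y\<in>S. mmul S A (minv S A) x y = idmat x y \<and> mmul S (minv S A) A x y = idmat x y"
    using someI_ex[OF ex_inverse_of_trivial_kernel[OF assms(1,2)]] by (simp add: minv_def)
  have "mv S (mmul S A (minv S A)) f x = mv S idmat f x"
    "mv S (mmul S (minv S A) A) f x = mv S idmat f x"
    using * x by (simp_all add: mv_def)
  then show "mv S A (mv S (minv S A) f) x = f x" "mv S (minv S A) (mv S A f) x = f x"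
    using assms(1) x by (simp_all add: mv_mmul mv_idmat)
qed

text \<open>A harmonic function attains its maximum over the states that can be entered, and
  irreducibility spreads the maximum over all of them.\<close>

lemma harmonic_const:
  assumes fin: "finite S" and ne: "S \<noteq> {}" and CS: "C \<subseteq> S"
    and st: "stoch S P" and col: "\<And>x y. x \<in> S \<Longrightarrow> y \<in> S - C \<Longrightarrow> P x y = 0"
    and irr: "irreducible_mat C P"
    and har: "\<And>x. x \<in> S \<Longrightarrow> mv S P h x = h x"
  shows "\<exists>c. \<forall>x\<in>S. h x = c"
proof -
  have finC: "finite C" using fin CS finite_subset by blast
  \<comment> \<open>No step leads outside \<open>C\<close>, so \<open>P\<close> is also stochastic
    as a matrix on \<open>C\<close> alone.\<close>
  have sumC: "(\<Sum>y\<in>S. P x y * g y) = (\<Sum>y\<in>C. P x y * g y)" if "x \<in> S" for x g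
    using fin CS col that by (intro sum.mono_neutral_right) auto
  have mvC: "mv S P g x = mv C P g x" if "x \<in> S" for g x
    using sumC[OF that] by (simp add: mv_def)
  have stC: "stoch C P"
    using st CS sumC[where g = "\<lambda>_. 1"] by (auto simp: stoch_def subset_iff)
  have neC: "C \<noteq> {}"
  proof
    assume "C = {}"
    then show False using ne sumC[where g = "\<lambda>_. 1"] st by (auto simp: stoch_def)
  qed
  have pw: "mv C (mpow C P n) h x = h x" if "x \<in> C" for n x
    using that
  proof (induction n arbitrary: x)
    case 0
    then show ?case by (simp add: mv_idmat finC)
  next
    case (Suc n)
    have "mv C (mpow C P (Suc n)) h x = mv C P h x"
      unfolding mpow.simps mv_mmul by (intro fun_cong[OF mv_cong] Suc.IH)
    also have "\<dots> = h x" using har[of x] mvC[of x h] Suc.prems CS by auto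
    finally show ?case .
  qed
  define m where "m = Max (h ` C)"
  have le: "h y \<le> m" if "y \<in> C" for y using finC that by (simp add: m_def)
  have "m \<in> h ` C" unfolding m_def using finC neC by (intro Max_in) auto
  then obtain x0 where x0: "x0 \<in> C" "h x0 = m" by auto
  have eq: "h y = m" if y: "y \<in> C" for y
  proof -
    obtain n where n: "mpow C P n x0 y > 0" using irr x0 y by (auto simp: irreducible_mat_def)
    have stn: "stoch C (mpow C P n)" by (rule stoch_mpow[OF finC stC])
    \<comment> \<open>The nonnegative function \<open>m - h\<close> has average 0 from the maximiser
      \<open>x0\<close>, so it vanishes wherever the \<open>n\<close>-step weight is positive, in
      particular at \<open>y\<close>.\<close>
    have "mv C (mpow C P n) (\<lambda>z. m - h z) x0 = 0"
      using stoch_mv_const[OF stn x0(1), of m] pw[OF x0(1)] x0(2) by (simp add: mv_diff)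
    then have "\<forall>z\<in>C. mpow C P n x0 z * (m - h z) = 0"
      unfolding mv_def using stn x0 le by (subst (asm) sum_nonneg_eq_0_iff) (auto simp: finC stoch_def)
    then show ?thesis using n y by force
  qed
  \<comment> \<open>Outside \<open>C\<close> too, \<open>h x\<close> is an average of values of
    \<open>h\<close> on \<open>C\<close>.\<close>
  have "h x = m" if x: "x \<in> S" for x
  proof -
    have "h x = (\<Sum>y\<in>C. P x y * m)" using har[OF x] mvC[OF x, of h] eq by (simp add: mv_def)
    also have "\<dots> = m"
      using sumC[OF x, of "\<lambda>_. m"] stoch_mv_const[OF st x, of m] by (simp add: mv_def)
    finally show ?thesis .
  qed
  then show ?thesis by blast
qed

section \<open>Stationary distributions and the fundamental matrix\<close>

lemma stationary_ip:
  assumes "stationary_dist S P \<pi>"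
  shows "ip S \<pi> (mv S P f) = ip S \<pi> f"
proof -
  have "ip S \<pi> (mv S P f) = (\<Sum>y\<in>S. (\<Sum>x\<in>S. \<pi> x * P x y) * f y)"
    unfolding ip_def mv_def sum_distrib_left sum_distrib_right by (subst sum.swap) (simp add: mult.assoc)
  then show ?thesis using assms by (simp add: stationary_dist_def ip_def)
qed

lemma ip_const: "stationary_dist S P \<pi> \<Longrightarrow> ip S \<pi> (\<lambda>_. c) = c"
  by (simp add: stationary_dist_def ip_def flip: sum_distrib_right)

text \<open>Let \<open>K = idmat - (P - one_row \<pi>)\<close>. Pairing \<open>K f = 0\<close> with
  the stationary \<open>\<pi>\<close> gives \<open>ip S \<pi> f = 0\<close>; then \<open>f\<close>
  is harmonic, hence constant, hence 0, and \<open>K\<close> is invertible. The conclusions are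
  \<open>K Z g = g\<close> written out, its pairing with \<open>\<pi>\<close>, and the fact that
  \<open>K\<close> fixes constants.\<close>

lemma fundamental_matrix:
  assumes fin: "finite S" and ne: "S \<noteq> {}" and "C \<subseteq> S"
    and st: "stoch S P" and "\<And>x y. x \<in> S \<Longrightarrow> y \<in> S - C \<Longrightarrow> P x y = 0"
    and "irreducible_mat C P" and stat: "stationary_dist S P \<pi>"
  defines "Z \<equiv> minv S (idmat - (P - one_row \<pi>))"
  shows "x \<in> S \<Longrightarrow> mv S Z g x = mv S P (mv S Z g) x + g x - ip S \<pi> g"
    and "ip S \<pi> (mv S Z g) = ip S \<pi> g"
    and "x \<in> S \<Longrightarrow> mv S Z (\<lambda>_. c) x = c"
proof -
  define K where "K = idmat - (P - one_row \<pi>)"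
  have K: "mv S K f y = f y - mv S P f y + ip S \<pi> f" if "y \<in> S" for f y
    using fin that by (simp add: K_def mv_minus mv_idmat mv_one_row)
  have ipK: "ip S \<pi> (mv S K f) = ip S \<pi> f" for f
  proof -
    have "ip S \<pi> (mv S K f) = ip S \<pi> (\<lambda>y. f y - mv S P f y + ip S \<pi> f)"
      by (intro ip_cong K)
    then show ?thesis by (simp add: ip_add ip_diff ip_const[OF stat] stationary_ip[OF stat])
  qed
  have ker: "f y = 0" if f0: "\<forall>x\<in>S. mv S K f x = 0" and y: "y \<in> S" for f y
  proof -
    have ip0: "ip S \<pi> f = 0"
      using ipK[of f] f0 by (simp add: ip_def)
    have "mv S P f x = f x" if "x \<in> S" for x
      using bspec[OF f0 that] K[OF that, of f] ip0 by simp
    from harmonic_const[OF fin ne assms(3) st assms(5,6) this]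
    obtain c where c: "\<And>x. x \<in> S \<Longrightarrow> f x = c" by blast
    then have "ip S \<pi> f = c" using ip_const[OF stat, of c] ip_cong[of S f "\<lambda>_. c" \<pi>] by simp
    then show ?thesis using ip0 c y by simp
  qed
  have ZK: "mv S K (mv S Z f) x = f x" "mv S Z (mv S K f) x = f x" if "x \<in> S" for f x
    unfolding Z_def K_def[symmetric] by (rule minv_inverse[OF fin _ that]; use ker in blast)+
  show ipZ: "ip S \<pi> (mv S Z g) = ip S \<pi> g" for g
    using ipK[of "mv S Z g"] ip_cong[of S "mv S K (mv S Z g)" g \<pi>, OF ZK(1)] by simp
  show "mv S Z g x = mv S P (mv S Z g) x + g x - ip S \<pi> g" if x: "x \<in> S"
    using ZK(1)[OF x, of g] K[OF x, of "mv S Z g"] ipZ by simp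
  have "mv S K (\<lambda>_. c) y = c" if "y \<in> S" for y
    using K[OF that, of "\<lambda>_. c"] stoch_mv_const[OF st that] ip_const[OF stat] by simp
  then have "mv S Z (\<lambda>_. c) = mv S Z (mv S K (\<lambda>_. c))"
    by (intro mv_cong) simp
  then show "mv S Z (\<lambda>_. c) x = c" if "x \<in> S" using ZK(2)[OF that] by simp
qed

section \<open>The periodic Poisson equation\<close>

text \<open>The mean of \<open>f\<close> at time \<open>k + j\<close> given the state at time
  \<open>k\<close>: a backward evolution, with the earliest kernel outermost.\<close>

primrec steps :: "'a set \<Rightarrow> (nat \<Rightarrow> 'a \<Rightarrow> 'a \<Rightarrow> real) \<Rightarrow> nat \<Rightarrow> nat \<Rightarrow> ('a \<Rightarrow> real) \<Rightarrow> 'a \<Rightarrow> real"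
  where
    "steps S Q 0 k f = f"
  | "steps S Q (Suc j) k f = mv S (Q k) (steps S Q j (Suc k) f)"

lemma steps_add: "steps S Q (i + j) k f = steps S Q i k (steps S Q j (k + i) f)"
  by (induction i arbitrary: k) simp_all

lemma steps_cong:
  assumes "\<And>y. y \<in> S \<Longrightarrow> f y = g y" "x \<in> S"
  shows "steps S Q j k f x = steps S Q j k g x"
  using assms(2)
proof (induction j arbitrary: k x)
  case (Suc j)
  then show ?case unfolding steps.simps by (intro fun_cong[OF mv_cong])
qed (simp add: assms)

lemma steps_diff: "steps S Q j k (\<lambda>y. f y - g y) = (\<lambda>x. steps S Q j k f x - steps S Q j k g x)"
  by (induction j arbitrary: k) (simp_all add: mv_diff)

lemma steps_const:
  assumes "\<And>i. stoch S (Q i)" "x \<in> S"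
  shows "steps S Q j k (\<lambda>_. c) x = c"
  using assms(2)
proof (induction j arbitrary: k x)
  case (Suc j)
  have "steps S Q (Suc j) k (\<lambda>_. c) x = mv S (Q k) (\<lambda>_. c) x"
    unfolding steps.simps using Suc.IH by (intro fun_cong[OF mv_cong])
  then show ?case using assms(1) Suc.prems by (simp add: stoch_mv_const)
qed simp

lemma steps_nonneg:
  assumes "\<And>i. stoch S (Q i)" "\<And>y. y \<in> S \<Longrightarrow> 0 \<le> f y" "x \<in> S"
  shows "0 \<le> steps S Q j k f x"
  using assms(3)
proof (induction j arbitrary: k x)
  case (Suc j)
  then show ?case using assms(1) by (auto simp: mv_def stoch_def intro!: sum_nonneg mult_nonneg_nonneg)
qed (simp add: assms)

lemma steps_kernel_cong:
  assumes "\<And>i. k \<le> i \<Longrightarrow> i < k + j \<Longrightarrow> Q i = R i"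
  shows "steps S Q j k f = steps S R j k f"
  using assms by (induction j arbitrary: k) simp_all

lemma steps_const_kernel:
  assumes "finite S" "x \<in> S"
  shows "steps S (\<lambda>_. A) j k f x = mv S (mpow S A j) f x"
  using assms(2)
proof (induction j arbitrary: k x)
  case 0
  then show ?case by (simp add: mv_idmat assms)
next
  case (Suc j)
  then show ?case by (auto simp: mv_mmul intro!: fun_cong[OF mv_cong])
qed

text \<open>\<open>P\<close> is a parameter of its own because the fundamental matrix is built from
  its entries, while the kernels are composed as operators; \<open>P_steps\<close> ties the two.
  \<open>C\<close> contains every state that a full period can reach.\<close>

locale periodic_kernels =
  fixes S C :: "'a set" and Q :: "nat \<Rightarrow> 'a \<Rightarrow> 'a \<Rightarrow> real" and T :: nat
    and P :: "'a \<Rightarrow> 'a \<Rightarrow> real" and \<pi> :: "'a \<Rightarrow> real"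
  assumes finite_S: "finite S" and S_ne: "S \<noteq> {}" and C_subset: "C \<subseteq> S"
    and T_pos: "0 < T" and Q_mod: "Q (k mod T) = Q k" and stoch_Q: "stoch S (Q k)"
    and stoch_P: "stoch S P"
    and P_steps: "x \<in> S \<Longrightarrow> mv S P f x = steps S Q T 0 f x"
    and P_outside: "x \<in> S \<Longrightarrow> y \<in> S - C \<Longrightarrow> P x y = 0"
    and irreducible_P: "irreducible_mat C P"
    and stationary_P: "stationary_dist S P \<pi>"
begin

text \<open>The stationary mean at phase \<open>k\<close>, not an expectation over the probability
  space of the chain.\<close>

definition E :: "nat \<Rightarrow> ('a \<Rightarrow> real) \<Rightarrow> real"
  where "E k f = ip S \<pi> (steps S Q k 0 f)"

definition Z :: "'a \<Rightarrow> 'a \<Rightarrow> real"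
  where "Z = minv S (idmat - (P - one_row \<pi>))"

lemma Z_poisson: "x \<in> S \<Longrightarrow> mv S Z g x = mv S P (mv S Z g) x + g x - ip S \<pi> g"
  and ip_Z: "ip S \<pi> (mv S Z g) = ip S \<pi> g"
  and Z_const: "x \<in> S \<Longrightarrow> mv S Z (\<lambda>_. c) x = c"
  unfolding Z_def
  using fundamental_matrix[OF finite_S S_ne C_subset stoch_P P_outside irreducible_P stationary_P]
  by blast+

lemma E_cong: "(\<And>y. y \<in> S \<Longrightarrow> f y = g y) \<Longrightarrow> E k f = E k g"
  unfolding E_def by (intro ip_cong steps_cong)

lemma E_diff: "E k (\<lambda>y. f y - g y) = E k f - E k g"
  by (simp add: E_def steps_diff ip_diff)

lemma E_add: "E k (\<lambda>y. f y + g y) = E k f + E k g"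
  using E_diff[of k "\<lambda>y. f y + g y" g] by simp

lemma E_const: "E k (\<lambda>_. c) = c"
proof -
  have "E k (\<lambda>_. c) = ip S \<pi> (\<lambda>_. c)"
    unfolding E_def by (intro ip_cong steps_const stoch_Q)
  then show ?thesis by (simp add: ip_const[OF stationary_P])
qed

lemma steps_scale: "steps S Q j k (\<lambda>y. c * f y) = (\<lambda>x. c * steps S Q j k f x)"
  by (induction j arbitrary: k) (simp_all add: mv_scale)

lemma E_scale: "E k (\<lambda>y. c * f y) = c * E k f"
  by (simp add: E_def steps_scale ip_scale)

lemma E_nonneg:
  assumes "\<And>y. y \<in> S \<Longrightarrow> 0 \<le> f y"
  shows "0 \<le> E k f"
  unfolding E_def ip_def
  using stationary_P steps_nonneg[of S Q, OF stoch_Q assms]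
  by (auto simp: stationary_dist_def intro!: sum_nonneg mult_nonneg_nonneg)

lemma E_step: "E k (mv S (Q k) f) = E (Suc k) f"
  using steps_add[of S Q k 1 0 f] by (simp add: E_def)

lemma E_0: "E 0 f = ip S \<pi> f"
  by (simp add: E_def)

lemma E_period: "E T f = E 0 f"
proof -
  have "E T f = ip S \<pi> (mv S P f)"
    unfolding E_def by (intro ip_cong) (simp add: P_steps)
  then show ?thesis by (simp add: stationary_ip[OF stationary_P] E_0)
qed

text \<open>The centred functions of one period, pulled back to its start, form the right-hand side
  of a Poisson equation for \<open>P\<close>; this is its solution.\<close>

definition poisson0 :: "(nat \<Rightarrow> 'a \<Rightarrow> real) \<Rightarrow> 'a \<Rightarrow> real"
  where "poisson0 f = mv S Z (\<lambda>x. \<Sum>l<T. steps S Q l 0 (\<lambda>y. f l y - E l (f l)) x)"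

text \<open>Backward recursion through one period with terminal value \<open>poisson0 f\<close> at
  phase \<open>T\<close>. Phases run over \<open>0..T\<close>, and the two ends must be shown to
  agree.\<close>

definition poisson :: "(nat \<Rightarrow> 'a \<Rightarrow> real) \<Rightarrow> nat \<Rightarrow> 'a \<Rightarrow> real"
  where "poisson f k = (\<lambda>x. (\<Sum>l\<in>{k..<T}. steps S Q (l - k) k (\<lambda>y. f l y - E l (f l)) x)
    + steps S Q (T - k) k (poisson0 f) x)"

lemma poisson_step:
  assumes "k < T"
  shows "poisson f k x = f k x - E k (f k) + mv S (Q k) (poisson f (Suc k)) x"
proof -
  define g where "g = (\<lambda>l y. f l y - E l (f l))"
  have eq: "steps S Q (l - k) k h = mv S (Q k) (steps S Q (l - Suc k) (Suc k) h)" if "Suc k \<le> l" for l h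
    using that steps.simps(2)[of S Q "l - Suc k" k h] by (simp add: Suc_diff_Suc)
  have "poisson f k x = steps S Q 0 k (g k) x + (\<Sum>l\<in>{Suc k..<T}. steps S Q (l - k) k (g l) x)
      + steps S Q (T - k) k (poisson0 f) x"
    using assms by (simp add: poisson_def g_def sum.atLeast_Suc_lessThan)
  also have "\<dots> = g k x + mv S (Q k) (poisson f (Suc k)) x"
    using assms by (simp add: poisson_def g_def mv_add mv_sum eq)
  finally show ?thesis by (simp add: g_def)
qed

lemma ip_centred: "ip S \<pi> (\<lambda>x. \<Sum>l<T. steps S Q l 0 (\<lambda>y. f l y - E l (f l)) x) = 0"
proof -
  have "ip S \<pi> (\<lambda>x. \<Sum>l<T. steps S Q l 0 (\<lambda>y. f l y - E l (f l)) x)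
      = (\<Sum>l<T. E l (\<lambda>y. f l y - E l (f l)))"
    by (simp add: ip_sum E_def)
  then show ?thesis by (simp add: E_diff E_const)
qed

text \<open>At phase 0 the definition gives the pulled-back sum plus \<open>P\<close> applied to
  \<open>poisson0 f\<close>. The sum has \<open>\<pi>\<close>-mean zero, so the equation for
  \<open>Z\<close> identifies this with \<open>poisson0 f\<close>, the value at phase
  \<open>T\<close>.\<close>

lemma poisson_wrap:
  assumes "x \<in> S"
  shows "poisson f T x = poisson f 0 x"
proof -
  have "poisson f 0 x = (\<Sum>l<T. steps S Q l 0 (\<lambda>y. f l y - E l (f l)) x) + mv S P (poisson0 f) x"
    by (simp add: poisson_def P_steps[OF assms] atLeast0LessThan)
  also have "\<dots> = poisson0 f x"
    using Z_poisson[OF assms, of "\<lambda>x. \<Sum>l<T. steps S Q l 0 (\<lambda>y. f l y - E l (f l)) x"]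
    unfolding ip_centred poisson0_def[symmetric] by simp
  finally show ?thesis by (simp add: poisson_def)
qed

text \<open>\<open>Z\<close> preserves \<open>\<pi>\<close>-means, which gives mean zero at phase 0,
  and the step equation carries it from phase to phase.\<close>

lemma poisson_centred: "k \<le> T \<Longrightarrow> E k (poisson f k) = 0"
proof (induction k)
  case 0
  have "E 0 (poisson f 0) = ip S \<pi> (poisson f T)"
    unfolding E_0 by (intro ip_cong poisson_wrap[symmetric])
  also have "\<dots> = ip S \<pi> (poisson0 f)" by (simp add: poisson_def)
  also have "\<dots> = 0" unfolding poisson0_def ip_Z by (rule ip_centred)
  finally show ?case .
next
  case (Suc k)
  have "E k (poisson f k) = E k (\<lambda>x. (f k x - E k (f k)) + mv S (Q k) (poisson f (Suc k)) x)"
    using Suc.prems by (intro E_cong) (simp add: poisson_step)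
  also have "\<dots> = E (Suc k) (poisson f (Suc k))"
    by (simp only: E_add E_diff E_const E_step)
  finally show ?case using Suc by simp
qed

end

section \<open>Martingale increments and their stationary variance\<close>

locale periodic_payoff = periodic_kernels +
  fixes W :: "'a \<Rightarrow> 'a \<Rightarrow> real"
begin

definition drift :: "nat \<Rightarrow> 'a \<Rightarrow> real"
  where "drift k = mv S (hadamard (Q k) W) (\<lambda>_. 1)"

text \<open>The next phase is \<open>Suc k\<close> without reduction modulo \<open>T\<close>, so
  that \<open>poisson_step\<close> applies as it stands even when \<open>Suc k = T\<close>.\<close>

definition increment :: "nat \<Rightarrow> 'a \<Rightarrow> 'a \<Rightarrow> real"
  where "increment k x y = W x y - E k (drift k) + poisson drift (Suc k) y - poisson drift k x"

definition increment_var :: "nat \<Rightarrow> 'a \<Rightarrow> real"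
  where "increment_var k x = (\<Sum>y\<in>S. Q k x y * (increment k x y)\<^sup>2)"

lemma row_sum: "x \<in> S \<Longrightarrow> (\<Sum>y\<in>S. Q k x y) = 1"
  using stoch_Q by (simp add: stoch_def)

lemma increment_mean:
  assumes "k < T" "x \<in> S"
  shows "(\<Sum>y\<in>S. Q k x y * increment k x y) = 0"
proof -
  have "(\<Sum>y\<in>S. Q k x y * increment k x y) = drift k x - E k (drift k) * (\<Sum>y\<in>S. Q k x y)
    + mv S (Q k) (poisson drift (Suc k)) x - poisson drift k x * (\<Sum>y\<in>S. Q k x y)"
  proof -
    define m h c where "m = E k (drift k)" and "h = poisson drift (Suc k)" and "c = poisson drift k x"
    show ?thesis
      unfolding increment_def m_def[symmetric] h_def[symmetric] c_def[symmetric]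
      by (simp add: drift_def hadamard_def mv_def algebra_simps sum.distrib sum_subtractf
          sum_distrib_left)
  qed
  also have "\<dots> = 0"
    using poisson_step[OF assms(1), of drift x] row_sum[OF assms(2)] by simp
  finally show ?thesis .
qed

lemma increment_var_expand:
  assumes "k < T" "x \<in> S"
    and "\<And>y. y \<in> S \<Longrightarrow> Q k x y * (W x y)\<^sup>2 = Q k x y"
  shows "increment_var k x = 1 - 2 * E k (drift k) * drift k x + (E k (drift k))\<^sup>2
    + 2 * mv S (hadamard (Q k) W) (poisson drift (Suc k)) x
    - 2 * E k (drift k) * mv S (Q k) (poisson drift (Suc k)) x
    + mv S (Q k) (\<lambda>y. (poisson drift (Suc k) y)\<^sup>2) x - (poisson drift k x)\<^sup>2"
proof -
  define m h c where "m = E k (drift k)" and "h = poisson drift (Suc k)" and "c = poisson drift k x"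
  \<comment> \<open>With \<open>a = W x y - m + h y\<close> the increment is \<open>a - c\<close>,
    and \<open>(a - c)^2 = a^2 - 2 c (a - c) - c^2\<close>; the middle term has conditional mean
    zero.\<close>
  have "increment_var k x = (\<Sum>y\<in>S. Q k x y * (W x y - m + h y)\<^sup>2
      - 2 * c * (Q k x y * increment k x y) - c\<^sup>2 * Q k x y)"
    unfolding increment_var_def increment_def m_def[symmetric] h_def[symmetric] c_def[symmetric]
    by (intro sum.cong refl) (simp add: power2_eq_square algebra_simps)
  also have "\<dots> = (\<Sum>y\<in>S. Q k x y * (W x y - m + h y)\<^sup>2) - c\<^sup>2"
    using increment_mean[OF assms(1,2)] row_sum[OF assms(2)]
    by (simp add: sum_subtractf flip: sum_distrib_left)
  also have "(\<Sum>y\<in>S. Q k x y * (W x y - m + h y)\<^sup>2) = (\<Sum>y\<in>S. Q k x y * (W x y)\<^sup>2 - 2 * m * (Q k x y * W x y)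
      + m\<^sup>2 * Q k x y + 2 * (Q k x y * W x y * h y) - 2 * m * (Q k x y * h y) + Q k x y * (h y)\<^sup>2)"
    by (intro sum.cong refl) (simp add: power2_eq_square algebra_simps)
  \<comment> \<open>On every transition of nonzero weight the payoff is 1 or -1, so its second
    moment is the row sum.\<close>
  also have "\<dots> = (\<Sum>y\<in>S. Q k x y) - 2 * m * drift k x + m\<^sup>2 * (\<Sum>y\<in>S. Q k x y)
     + 2 * mv S (hadamard (Q k) W) h x - 2 * m * mv S (Q k) h x + mv S (Q k) (\<lambda>y. (h y)\<^sup>2) x"
    using sum.cong[OF refl assms(3), of S "\<lambda>y. y"]
    by (simp add: sum.distrib sum_subtractf drift_def mv_def hadamard_def flip: sum_distrib_left)
  finally show ?thesis
    using row_sum[OF assms(2)] by (simp add: m_def h_def c_def)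
qed

text \<open>The squared corrector telescopes over a period, leaving the covariances with the corrector.\<close>

lemma sum_increment_var:
  assumes "\<And>k x y. k < T \<Longrightarrow> x \<in> S \<Longrightarrow> y \<in> S \<Longrightarrow> Q k x y * (W x y)\<^sup>2 = Q k x y"
  shows "(\<Sum>k<T. E k (increment_var k)) = real T - (\<Sum>k<T. (E k (drift k))\<^sup>2)
    + 2 * (\<Sum>k<T. E k (mv S (hadamard (Q k) W) (poisson drift (Suc k))))"
proof -
  define G where "G k = E k (\<lambda>x. (poisson drift k x)\<^sup>2)" for k
  have "E k (increment_var k) = 1 - (E k (drift k))\<^sup>2
      + 2 * E k (mv S (hadamard (Q k) W) (poisson drift (Suc k))) + (G (Suc k) - G k)"
    if k: "k < T" for k
  proof -
    have "E k (increment_var k) = E k (\<lambda>x. 1 - 2 * E k (drift k) * drift k x + (E k (drift k))\<^sup>2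
      + 2 * mv S (hadamard (Q k) W) (poisson drift (Suc k)) x
      - 2 * E k (drift k) * mv S (Q k) (poisson drift (Suc k)) x
      + mv S (Q k) (\<lambda>y. (poisson drift (Suc k) y)\<^sup>2) x - (poisson drift k x)\<^sup>2)"
      using k assms by (intro E_cong increment_var_expand)
    \<comment> \<open>The corrector is centred at phase \<open>Suc k\<close>, so its product with
      the payoff mean drops out; its square is moved to that phase by \<open>E_step\<close>.\<close>
    then show ?thesis
      using poisson_centred[of "Suc k" drift] k
      by (simp add: E_diff E_add E_scale E_const E_step[of k "\<lambda>y. (poisson drift (Suc k) y)\<^sup>2"]
          E_step[of k "poisson drift (Suc k)"] G_def power2_eq_square[of "E k (drift k)"])
  qed
  then have "(\<Sum>k<T. E k (increment_var k)) = (\<Sum>k<T. 1 - (E k (drift k))\<^sup>2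
      + 2 * E k (mv S (hadamard (Q k) W) (poisson drift (Suc k))) + (G (Suc k) - G k))"
    by (intro sum.cong) auto
  also have "\<dots> = real T - (\<Sum>k<T. (E k (drift k))\<^sup>2)
      + 2 * (\<Sum>k<T. E k (mv S (hadamard (Q k) W) (poisson drift (Suc k)))) + (G T - G 0)"
    using sum_lessThan_telescope[of G T] by (simp add: sum.distrib sum_subtractf flip: sum_distrib_left)
  \<comment> \<open>The telescoping sum closes: stationarity returns the law after a period, and the
    corrector is periodic.\<close>
  also have "G T = G 0"
    unfolding G_def E_period by (intro E_cong) (simp add: poisson_wrap)
  finally show ?thesis by simp
qed

end

section \<open>A strong law for bounded increments\<close>

text \<open>Each \<open>n\<close> is within \<open>2 * m\<close> of the largest square
  \<open>m\<^sup>2\<close> below it; relative to \<open>m\<^sup>2\<close> the movement in between is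
  at most \<open>2 * K / m\<close>.\<close>

lemma bounded_increments_tendsto:
  fixes Y :: "nat \<Rightarrow> real"
  assumes K: "0 \<le> K" "\<And>n. \<bar>Y (Suc n) - Y n\<bar> \<le> K"
    and lim: "(\<lambda>m. \<bar>Y (m\<^sup>2)\<bar> / (real m)\<^sup>2) \<longlonglongrightarrow> 0"
  shows "(\<lambda>n. Y n / real n) \<longlonglongrightarrow> 0"
proof -
  have step: "\<bar>Y (n + j) - Y n\<bar> \<le> real j * K" for n j
  proof (induction j)
    case (Suc j)
    have "\<bar>Y (n + Suc j) - Y n\<bar> \<le> \<bar>Y (Suc (n + j)) - Y (n + j)\<bar> + \<bar>Y (n + j) - Y n\<bar>"
      by simp
    also have "\<dots> \<le> K + real j * K" by (intro add_mono Suc K(2))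
    finally show ?case by (simp add: algebra_simps)
  qed simp
  have bound: "\<bar>Y n / real n\<bar> \<le>
      \<bar>Y ((floor_sqrt n)\<^sup>2)\<bar> / (real (floor_sqrt n))\<^sup>2 + 2 * K / real (floor_sqrt n)" if "n > 0" for n
  proof -
    define m where "m = floor_sqrt n"
    have mn: "m\<^sup>2 \<le> n" "0 < m" using that by (auto simp: m_def)
    have "n < (Suc m)\<^sup>2" unfolding m_def by (rule Suc_floor_sqrt_power2_gt)
    then have mn2: "n \<le> m\<^sup>2 + 2 * m" by (simp add: power2_eq_square)
    define j where "j = n - m\<^sup>2"
    have j: "n = m\<^sup>2 + j" using mn by (simp add: j_def)
    have "j \<le> 2 * m" using mn2 j by linarith
    then have j2: "real j \<le> 2 * real m" by linarith
    have "\<bar>Y n\<bar> \<le> \<bar>Y (m\<^sup>2)\<bar> + 2 * real m * K"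
      using step[of "m\<^sup>2" j] mult_right_mono[OF j2 K(1)] unfolding j[symmetric] by linarith
    then have "\<bar>Y n / real n\<bar> \<le> (\<bar>Y (m\<^sup>2)\<bar> + 2 * real m * K) / real n"
      by (simp add: divide_right_mono)
    also have "\<dots> \<le> (\<bar>Y (m\<^sup>2)\<bar> + 2 * real m * K) / (real m)\<^sup>2"
      using mn K(1) that of_nat_mono[OF mn(1), where 'a = real] by (intro divide_left_mono) auto
    also have "\<dots> = \<bar>Y (m\<^sup>2)\<bar> / (real m)\<^sup>2 + 2 * K / real m"
      using mn by (simp add: field_simps power2_eq_square)
    finally show ?thesis by (simp add: m_def)
  qed
  have sqrt_top: "filterlim floor_sqrt at_top sequentially"
    unfolding filterlim_at_top
  proof
    fix Z :: nat
    show "\<forall>\<^sub>F n in sequentially. Z \<le> floor_sqrt n"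
      using eventually_ge_at_top[of "Z\<^sup>2"]
      by eventually_elim (simp add: le_floor_sqrt_iff)
  qed
  have lim1: "(\<lambda>m. \<bar>Y (m\<^sup>2)\<bar> / (real m)\<^sup>2 + 2 * K / real m) \<longlonglongrightarrow> 0"
    using tendsto_add[OF lim lim_const_over_n[of "2 * K"]] by simp
  have "(\<lambda>n. \<bar>Y n / real n\<bar>) \<longlonglongrightarrow> 0"
  proof (rule tendsto_sandwich[OF _ _ tendsto_const filterlim_compose[OF lim1 sqrt_top]])
    show "\<forall>\<^sub>F n in sequentially. \<bar>Y n / real n\<bar> \<le>
      \<bar>Y ((floor_sqrt n)\<^sup>2)\<bar> / (real (floor_sqrt n))\<^sup>2 + 2 * K / real (floor_sqrt n)"
      using bound by (intro eventually_sequentiallyI[of 1]) auto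
  qed simp
  then show ?thesis by (rule tendsto_rabs_zero_cancel)
qed

context prob_space
begin

text \<open>A finite-valued variable is a finite combination of indicators. Banach-valued
  \<open>f\<close> covers both real second moments and complex characteristic functions.\<close>

lemma finite_valued_expectation:
  fixes f :: "'b \<Rightarrow> 'c :: {banach, second_countable_topology}"
  assumes fin: "finite H" and Y: "Y \<in> measurable M (count_space H)"
  shows "integrable M (\<lambda>\<omega>. f (Y \<omega>))"
    and "expectation (\<lambda>\<omega>. f (Y \<omega>)) = (\<Sum>h\<in>H. prob (Y -` {h} \<inter> space M) *\<^sub>R f h)"
proof -
  have m: "Y -` {h} \<inter> space M \<in> events" if "h \<in> H" for h
    using that by (intro measurable_sets[OF Y]) auto
  have eq: "f (Y \<omega>) = (\<Sum>h\<in>H. indicator (Y -` {h} \<inter> space M) \<omega> *\<^sub>R f h)" if "\<omega> \<in> space M" for \<omega>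
  proof -
    have "(\<Sum>h\<in>H. indicator (Y -` {h} \<inter> space M) \<omega> *\<^sub>R f h) = (\<Sum>h\<in>H. if Y \<omega> = h then f h else 0)"
      using that by (intro sum.cong refl) auto
    then show ?thesis
      using measurable_space[OF Y that] fin by (simp add: sum.delta')
  qed
  have int: "integrable M (\<lambda>\<omega>. indicator (Y -` {h} \<inter> space M) \<omega> *\<^sub>R f h)" if "h \<in> H" for h
    using m[OF that] by (intro integrable_scaleR_left) (simp add: emeasure_eq_measure)
  show "integrable M (\<lambda>\<omega>. f (Y \<omega>))"
    using int by (subst Bochner_Integration.integrable_cong[OF refl eq]) auto
  have "expectation (\<lambda>\<omega>. f (Y \<omega>)) = (\<integral>\<omega>. (\<Sum>h\<in>H. indicator (Y -` {h} \<inter> space M) \<omega> *\<^sub>R f h) \<partial>M)"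
    by (intro Bochner_Integration.integral_cong refl eq)
  also have "\<dots> = (\<Sum>h\<in>H. prob (Y -` {h} \<inter> space M) *\<^sub>R f h)"
    using int m by (subst Bochner_Integration.integral_sum) (auto simp: emeasure_eq_measure)
  finally show "expectation (\<lambda>\<omega>. f (Y \<omega>)) = (\<Sum>h\<in>H. prob (Y -` {h} \<inter> space M) *\<^sub>R f h)" .
qed

text \<open>Along the squares the second moments are summable, and between consecutive squares
  \<open>m\<^sup>2\<close> and \<open>(m + 1)\<^sup>2\<close> the process moves by at most \<open>2 m K\<close>.\<close>

lemma bounded_increments_slln:
  fixes Y :: "nat \<Rightarrow> 'a \<Rightarrow> real"
  assumes meas [measurable]: "\<And>n. Y n \<in> borel_measurable M"
    and K: "0 \<le> K" "\<And>n \<omega>. \<omega> \<in> space M \<Longrightarrow> \<bar>Y (Suc n) \<omega> - Y n \<omega>\<bar> \<le> K"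
    and sq: "\<And>n. integrable M (\<lambda>\<omega>. (Y n \<omega>)\<^sup>2)" "\<And>n. expectation (\<lambda>\<omega>. (Y n \<omega>)\<^sup>2) \<le> real n * K\<^sup>2"
  shows "AE \<omega> in M. (\<lambda>n. Y n \<omega> / real n) \<longlonglongrightarrow> 0"
proof -
  \<comment> \<open>The normalisation by \<open>m ^ 4\<close> leaves expectations of order
    \<open>1 / m\<^sup>2\<close>. The term \<open>m = 0\<close> is 0 by the convention for division
    by zero.\<close>
  define R where "R = (\<lambda>m \<omega>. (Y (m\<^sup>2) \<omega>)\<^sup>2 / real m ^ 4)"
  have R_meas [measurable]: "R m \<in> borel_measurable M" for m
    unfolding R_def by measurable
  have R_nonneg: "0 \<le> R m \<omega>" for m \<omega> by (simp add: R_def)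
  have R_int: "integrable M (R m)" for m
    unfolding R_def using sq(1) by (intro integrable_divide)
  have R_le: "expectation (R m) \<le> K\<^sup>2 * (1 / (real m)\<^sup>2)" for m
  proof -
    have "expectation (R m) = expectation (\<lambda>\<omega>. (Y (m\<^sup>2) \<omega>)\<^sup>2) / real m ^ 4"
      by (simp add: R_def)
    also have "\<dots> \<le> real (m\<^sup>2) * K\<^sup>2 / real m ^ 4"
      using sq(2)[of "m\<^sup>2"] by (intro divide_right_mono) auto
    also have "\<dots> = K\<^sup>2 * (1 / (real m)\<^sup>2)"
      by (cases "m = 0") (auto simp: field_simps power2_eq_square power4_eq_xxxx)
    finally show ?thesis .
  qed
  have summ: "summable (\<lambda>m. K\<^sup>2 * (1 / (real m)\<^sup>2))"
    using inverse_power_summable[of 2, where 'a = real] by (intro summable_mult) (simp add: field_simps)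
  \<comment> \<open>A series of finite total expectation converges almost surely, so its terms tend
    to 0.\<close>
  have "(\<integral>\<^sup>+\<omega>. (\<Sum>m. ennreal (R m \<omega>)) \<partial>M) = (\<Sum>m. \<integral>\<^sup>+\<omega>. ennreal (R m \<omega>) \<partial>M)"
    by (intro nn_integral_suminf) measurable
  also have "\<dots> = (\<Sum>m. ennreal (expectation (R m)))"
    using R_int R_nonneg by (intro suminf_cong nn_integral_eq_integral) auto
  also have "\<dots> \<le> (\<Sum>m. ennreal (K\<^sup>2 * (1 / (real m)\<^sup>2)))"
    by (intro suminf_le ennreal_leI R_le) auto
  also have "\<dots> < \<infinity>"
    using summ by (subst suminf_ennreal2) auto
  finally have "AE \<omega> in M. (\<Sum>m. ennreal (R m \<omega>)) \<noteq> \<infinity>"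
    by (intro nn_integral_PInf_AE) auto
  with AE_space show ?thesis
  proof eventually_elim
    case (elim \<omega>)
    have "summable (\<lambda>m. R m \<omega>)"
      using elim(2) R_nonneg by (intro summable_suminf_not_top) auto
    then have "(\<lambda>m. sqrt (R m \<omega>)) \<longlonglongrightarrow> sqrt 0"
      by (intro tendsto_real_sqrt summable_LIMSEQ_zero)
    moreover have "sqrt (R m \<omega>) = \<bar>Y (m\<^sup>2) \<omega>\<bar> / (real m)\<^sup>2" for m
    proof -
      have "real m ^ 4 = ((real m)\<^sup>2)\<^sup>2" by simp
      then show ?thesis by (simp only: R_def real_sqrt_divide real_sqrt_abs) simp
    qed
    ultimately have "(\<lambda>m. \<bar>Y (m\<^sup>2) \<omega>\<bar> / (real m)\<^sup>2) \<longlonglongrightarrow> 0" by simp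
    then show ?case
      by (intro bounded_increments_tendsto[of K "\<lambda>n. Y n \<omega>"] K(1) K(2)[OF elim(1)])
  qed
qed

end

section \<open>Martingales over a finite Markov chain\<close>

locale finite_markov_chain =
  fixes S :: "'a set" and \<Omega> :: "'w measure" and Q :: "nat \<Rightarrow> 'a \<Rightarrow> 'a \<Rightarrow> real"
    and X :: "nat \<Rightarrow> 'w \<Rightarrow> 'a"
  assumes finite_states: "finite S" and chain: "markov_chain S \<Omega> Q X"
begin

sublocale prob_space \<Omega>
  using chain by (simp add: markov_chain_def)

lemma X_measurable [measurable]: "X n \<in> measurable \<Omega> (count_space S)"
  using chain by (simp add: markov_chain_def)

lemma X_in: "\<omega> \<in> space \<Omega> \<Longrightarrow> X n \<omega> \<in> S"
  using measurable_space[OF X_measurable] by simp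

text \<open>\<open>markov_chain\<close> conditions on the whole past, so the past is packed into one
  variable. Restriction makes histories extensional, hence finite in number.\<close>

definition hist :: "nat \<Rightarrow> 'w \<Rightarrow> nat \<Rightarrow> 'a"
  where "hist n \<omega> = (\<lambda>k\<in>{..n}. X k \<omega>)"

abbreviation hists :: "nat \<Rightarrow> (nat \<Rightarrow> 'a) set"
  where "hists n \<equiv> {..n} \<rightarrow>\<^sub>E S"

lemma finite_hists: "finite (hists n)"
  using finite_states by (intro finite_PiE) auto

lemma hist_eq_iff:
  assumes "h \<in> hists n"
  shows "hist n \<omega> = h \<longleftrightarrow> (\<forall>k\<le>n. X k \<omega> = h k)"
proof
  assume "\<forall>k\<le>n. X k \<omega> = h k"
  then show "hist n \<omega> = h"
    using assms by (intro PiE_ext[of _ "{..n}" "\<lambda>k. {h k}"]) (auto simp: hist_def PiE_def)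
qed (auto simp: hist_def)

lemma X_event [measurable]: "{\<omega> \<in> space \<Omega>. X k \<omega> = x} \<in> events"
proof (cases "x \<in> S")
  case True
  have "X k -` {x} \<inter> space \<Omega> \<in> events"
    using True by (intro measurable_sets[OF X_measurable]) auto
  then show ?thesis by (simp add: vimage_def Int_def conj_commute)
next
  case False
  then have "{\<omega> \<in> space \<Omega>. X k \<omega> = x} = {}" using X_in by auto
  then show ?thesis by simp
qed

lemma hist_measurable [measurable]: "hist n \<in> measurable \<Omega> (count_space (hists n))"
proof -
  have "hist n -` {h} \<inter> space \<Omega> \<in> events" if h: "h \<in> hists n" for h
  proof -
    have "hist n -` {h} \<inter> space \<Omega> = {\<omega> \<in> space \<Omega>. \<forall>k\<in>{..n}. X k \<omega> = h k}"
      using hist_eq_iff[OF h] by auto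
    also have "\<dots> \<in> events" by (intro sets.sets_Collect_finite_All X_event) auto
    finally show ?thesis .
  qed
  then show ?thesis
    using finite_hists by (subst measurable_count_space_eq2) (auto simp: hist_def X_in)
qed

text \<open>The Markov condition speaks only of histories of positive probability; for a null
  history both sides are 0.\<close>

lemma transition_prob:
  assumes h: "h \<in> hists n" and y: "y \<in> S"
  shows "prob ((\<lambda>\<omega>. (hist n \<omega>, X (Suc n) \<omega>)) -` {(h, y)} \<inter> space \<Omega>)
    = prob (hist n -` {h} \<inter> space \<Omega>) * Q n (h n) y"
proof -
  let ?A = "{\<omega> \<in> space \<Omega>. \<forall>k\<le>n. X k \<omega> = h k}"
  let ?B = "{\<omega> \<in> space \<Omega>. X (Suc n) \<omega> = y \<and> (\<forall>k\<le>n. X k \<omega> = h k)}"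
  have A: "hist n -` {h} \<inter> space \<Omega> = ?A" using hist_eq_iff[OF h] by auto
  have B: "(\<lambda>\<omega>. (hist n \<omega>, X (Suc n) \<omega>)) -` {(h, y)} \<inter> space \<Omega> = ?B"
    using hist_eq_iff[OF h] by auto
  have "?A \<in> events"
    using measurable_sets[OF hist_measurable, of "{h}" n] h unfolding A by simp
  then have le: "prob ?B \<le> prob ?A" by (intro finite_measure_mono) auto
  have "prob ?B = prob ?A * Q n (h n) y"
  proof (cases "prob ?A > 0")
    case True
    then have "\<P>(\<omega> in \<Omega>. X (Suc n) \<omega> = y \<bar> \<forall>k\<le>n. X k \<omega> = h k) = Q n (h n) y"
      using chain y unfolding markov_chain_def by blast
    then show ?thesis using True by (simp add: cond_prob_def field_simps)
  next
    case False
    then show ?thesis using le measure_nonneg[of \<Omega> ?A] measure_nonneg[of \<Omega> ?B] by simp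
  qed
  then show ?thesis by (simp only: A B)
qed

text \<open>The Markov property in integrated form: against a factor known from the past, a function
  of the next transition may be replaced by its conditional mean.\<close>

lemma hist_expectation_step:
  fixes F :: "(nat \<Rightarrow> 'a) \<Rightarrow> 'b :: {real_normed_algebra, banach, second_countable_topology}"
  shows "expectation (\<lambda>\<omega>. F (hist n \<omega>) * G (X n \<omega>) (X (Suc n) \<omega>))
    = expectation (\<lambda>\<omega>. F (hist n \<omega>) * (\<Sum>y\<in>S. Q n (X n \<omega>) y *\<^sub>R G (X n \<omega>) y))"
proof -
  let ?Y = "\<lambda>\<omega>. (hist n \<omega>, X (Suc n) \<omega>)"
  have Y: "?Y \<in> measurable \<Omega> (count_space (hists n \<times> S))"
  proof -
    have "?Y -` {(h, y)} \<inter> space \<Omega> \<in> events" if "h \<in> hists n" "y \<in> S" for h y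
    proof -
      have "?Y -` {(h, y)} \<inter> space \<Omega> = (hist n -` {h} \<inter> space \<Omega>) \<inter> {\<omega> \<in> space \<Omega>. X (Suc n) \<omega> = y}"
        by auto
      then show ?thesis
        using measurable_sets[OF hist_measurable, of "{h}" n] that by auto
    qed
    then show ?thesis
      using finite_hists finite_states
      by (subst measurable_count_space_eq2) (auto simp: hist_def X_in)
  qed
  have Xn: "X n \<omega> = hist n \<omega> n" for \<omega> by (simp add: hist_def)
  have "expectation (\<lambda>\<omega>. F (hist n \<omega>) * G (X n \<omega>) (X (Suc n) \<omega>))
      = expectation (\<lambda>\<omega>. (\<lambda>(h, y). F h * G (h n) y) (?Y \<omega>))"
    by (simp add: Xn)
  also have "\<dots> = (\<Sum>z\<in>hists n \<times> S. prob (?Y -` {z} \<inter> space \<Omega>) *\<^sub>R (\<lambda>(h, y). F h * G (h n) y) z)"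
    using finite_hists finite_states by (intro finite_valued_expectation(2) Y) auto
  also have "\<dots> = (\<Sum>h\<in>hists n. \<Sum>y\<in>S. (prob (hist n -` {h} \<inter> space \<Omega>) * Q n (h n) y) *\<^sub>R (F h * G (h n) y))"
    unfolding sum.cartesian_product
    by (intro sum.cong refl) (clarsimp, subst transition_prob, auto)
  also have "\<dots> = (\<Sum>h\<in>hists n. prob (hist n -` {h} \<inter> space \<Omega>) *\<^sub>R (F h * (\<Sum>y\<in>S. Q n (h n) y *\<^sub>R G (h n) y)))"
    by (simp add: sum_distrib_left scaleR_sum_right)
  also have "\<dots> = expectation (\<lambda>\<omega>. F (hist n \<omega>) * (\<Sum>y\<in>S. Q n (hist n \<omega> n) y *\<^sub>R G (hist n \<omega> n) y))"
    using finite_valued_expectation(2)[OF finite_hists hist_measurable[of n],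
        of "\<lambda>h. F h * (\<Sum>y\<in>S. Q n (h n) y *\<^sub>R G (h n) y)"] by simp
  finally show ?thesis by (simp add: Xn)
qed

lemma hist_integrable:
  fixes F :: "(nat \<Rightarrow> 'a) \<Rightarrow> 'b :: {banach, second_countable_topology}"
  shows "integrable \<Omega> (\<lambda>\<omega>. F (hist n \<omega>))"
  by (rule finite_valued_expectation(1)[OF finite_hists hist_measurable])

end

section \<open>Bounds for real and imaginary exponentials\<close>

lemma exp_minus_bounds:
  fixes a :: real
  assumes "0 \<le> a"
  shows "\<bar>exp (- a) - (1 - a)\<bar> \<le> a\<^sup>2 / 2" "\<bar>1 - exp (- a)\<bar> \<le> a"
proof -
  have low: "1 - a \<le> exp (- a)" using exp_ge_add_one_self[of "- a"] by simp
  show "\<bar>1 - exp (- a)\<bar> \<le> a" using low assms by simp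
  \<comment> \<open>The auxiliary function is 0 at 0 and nondecreasing, which gives the upper bound
    \<open>exp (- a) \<le> 1 - a + a\<^sup>2 / 2\<close>.\<close>
  have "(\<lambda>x. x\<^sup>2 / 2 - exp (- x) + 1 - x) 0 \<le> (\<lambda>x. x\<^sup>2 / 2 - exp (- x) + 1 - x) a"
  proof (rule DERIV_nonneg_imp_nondecreasing[OF assms])
    fix x :: real
    have "((\<lambda>x. x\<^sup>2 / 2 - exp (- x) + 1 - x) has_real_derivative (x + exp (- x) - 1)) (at x)"
      by (auto intro!: derivative_eq_intros)
    moreover have "0 \<le> x + exp (- x) - 1" using exp_ge_add_one_self[of "- x"] by simp
    ultimately show "\<exists>y. ((\<lambda>x. x\<^sup>2 / 2 - exp (- x) + 1 - x) has_real_derivative y) (at x) \<and> 0 \<le> y"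
      by blast
  qed
  then show "\<bar>exp (- a) - (1 - a)\<bar> \<le> a\<^sup>2 / 2" using low by simp
qed

text \<open>Used with \<open>p\<close> the characteristic function, \<open>q\<close> its weighted
  version, \<open>r\<close> the weighted version at time 0 and \<open>e\<close> the Gaussian
  factor.\<close>

lemma norm_diff_chain:
  fixes p q e r :: complex
  assumes "cmod (p - q) \<le> A" "cmod (q - e * r) \<le> B" "cmod (e * (r - 1)) \<le> C"
  shows "cmod (p - e) \<le> A + (B + C)"
proof -
  have "p - e = (p - q) + ((q - e * r) + e * (r - 1))" by (simp add: algebra_simps)
  then show ?thesis
    using norm_triangle_le[OF add_mono[OF assms(1) norm_triangle_le[OF add_mono[OF assms(2,3)]]]]
    by (simp only:)
qed

text \<open>Second-order Taylor expansion in which the perturbation \<open>b\<close> counts as a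
  second-order term; \<open>b\<close> stands for the corrector term of the weight, and its product
  with \<open>iexp x - 1\<close> is of higher order.\<close>

lemma iexp_perturbed_le:
  fixes x b :: real
  shows "cmod (iexp x * (1 - of_real b) - (1 + \<i> * of_real x - of_real (x\<^sup>2 / 2 + b)))
    \<le> \<bar>x\<bar> ^ 3 / 6 + \<bar>b\<bar> * \<bar>x\<bar>"
proof -
  have 1: "cmod (iexp x - (1 + \<i> * of_real x - of_real (x\<^sup>2 / 2))) \<le> \<bar>x\<bar> ^ 3 / 6"
  proof -
    have "{..2::nat} = {0, 1, 2}" by auto
    then show ?thesis
      using iexp_approx1[of x 2] by (simp add: power_mult_distrib fact_numeral algebra_simps)
  qed
  have 2: "cmod (iexp x - 1) \<le> \<bar>x\<bar>"
    using iexp_approx1[of x 0] by simp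
  have "iexp x * (1 - of_real b) - (1 + \<i> * of_real x - of_real (x\<^sup>2 / 2 + b))
      = (iexp x - (1 + \<i> * of_real x - of_real (x\<^sup>2 / 2))) - of_real b * (iexp x - 1)"
    by (simp add: algebra_simps)
  also have "cmod \<dots> \<le> \<bar>x\<bar> ^ 3 / 6 + \<bar>b\<bar> * \<bar>x\<bar>"
    using 1 mult_left_mono[OF 2, of "\<bar>b\<bar>"]
    by (intro order.trans[OF norm_triangle_ineq4]) (simp add: norm_mult)
  finally show ?thesis .
qed

locale markov_martingale = finite_markov_chain +
  fixes d :: "nat \<Rightarrow> 'a \<Rightarrow> 'a \<Rightarrow> real" and K :: real
  assumes stoch: "stoch S (Q n)"
    and d_bound: "x \<in> S \<Longrightarrow> y \<in> S \<Longrightarrow> \<bar>d n x y\<bar> \<le> K"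
    and d_mean: "x \<in> S \<Longrightarrow> (\<Sum>y\<in>S. Q n x y * d n x y) = 0"
begin

definition mart :: "nat \<Rightarrow> 'b \<Rightarrow> real"
  where "mart n \<omega> = (\<Sum>k<n. d k (X k \<omega>) (X (Suc k) \<omega>))"

lemma mart_hist: "mart n \<omega> = (\<Sum>k<n. d k (hist n \<omega> k) (hist n \<omega> (Suc k)))"
  by (simp add: mart_def hist_def)

lemma integrable_mart:
  fixes f :: "real \<Rightarrow> 'a \<Rightarrow> 'a \<Rightarrow> 'c :: {banach, second_countable_topology}"
  shows "integrable \<Omega> (\<lambda>\<omega>. f (mart n \<omega>) (X n \<omega>) (X (Suc n) \<omega>))"
  using hist_integrable[of "\<lambda>h. f (\<Sum>k<n. d k (h k) (h (Suc k))) (h n) (h (Suc n))" "Suc n"]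
  by (simp add: mart_def hist_def)

lemma mart_measurable [measurable]: "mart n \<in> borel_measurable \<Omega>"
  using integrable_mart[of "\<lambda>m x y. m"] by (rule borel_measurable_integrable)

lemma mart_step:
  fixes f :: "real \<Rightarrow> 'c :: {real_normed_algebra, banach, second_countable_topology}"
  shows "expectation (\<lambda>\<omega>. f (mart n \<omega>) * G (X n \<omega>) (X (Suc n) \<omega>))
    = expectation (\<lambda>\<omega>. f (mart n \<omega>) * (\<Sum>y\<in>S. Q n (X n \<omega>) y *\<^sub>R G (X n \<omega>) y))"
  using hist_expectation_step[of "\<lambda>h. f (\<Sum>k<n. d k (h k) (h (Suc k)))" n G]
  by (simp only: mart_hist)

lemma K_nonneg: "0 \<le> K"
proof -
  obtain \<omega> where \<omega>: "\<omega> \<in> space \<Omega>" using not_empty by blast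
  show ?thesis using d_bound[OF X_in[OF \<omega>] X_in[OF \<omega>], of 0 0 0] by linarith
qed

text \<open>Increments are orthogonal to the past, so the second moment grows by at most
  \<open>K\<^sup>2\<close> per step.\<close>

lemma mart_second_moment: "expectation (\<lambda>\<omega>. (mart n \<omega>)\<^sup>2) \<le> real n * K\<^sup>2"
proof (induction n)
  case 0
  then show ?case by (simp add: mart_def)
next
  case (Suc n)
  let ?d = "\<lambda>\<omega>. d n (X n \<omega>) (X (Suc n) \<omega>)"
  have int: "integrable \<Omega> (\<lambda>\<omega>. (mart n \<omega>)\<^sup>2)" "integrable \<Omega> (\<lambda>\<omega>. mart n \<omega> * ?d \<omega>)"
    "integrable \<Omega> (\<lambda>\<omega>. (?d \<omega>)\<^sup>2)"
    using integrable_mart[of "\<lambda>m x y. m\<^sup>2" n] integrable_mart[of "\<lambda>m x y. m * d n x y" n]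
      integrable_mart[of "\<lambda>m x y. (d n x y)\<^sup>2" n] by auto
  have "expectation (\<lambda>\<omega>. mart n \<omega> * ?d \<omega>) = expectation (\<lambda>\<omega>. mart n \<omega> * (\<Sum>y\<in>S. Q n (X n \<omega>) y *\<^sub>R d n (X n \<omega>) y))"
    by (rule mart_step)
  also have "\<dots> = expectation (\<lambda>\<omega>. 0)"
    using d_mean by (intro Bochner_Integration.integral_cong) (auto simp: X_in)
  finally have cross: "expectation (\<lambda>\<omega>. mart n \<omega> * ?d \<omega>) = 0" by simp
  have "expectation (\<lambda>\<omega>. (?d \<omega>)\<^sup>2) \<le> expectation (\<lambda>\<omega>. K\<^sup>2)"
  proof (intro integral_mono int)
    fix \<omega> assume "\<omega> \<in> space \<Omega>"
    then show "(?d \<omega>)\<^sup>2 \<le> K\<^sup>2" using d_bound X_in by (simp add: abs_le_square_iff[symmetric] K_nonneg)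
  qed simp
  then have sq: "expectation (\<lambda>\<omega>. (?d \<omega>)\<^sup>2) \<le> K\<^sup>2" by (simp add: prob_space)
  have "expectation (\<lambda>\<omega>. (mart (Suc n) \<omega>)\<^sup>2)
      = expectation (\<lambda>\<omega>. (mart n \<omega>)\<^sup>2 + 2 * (mart n \<omega> * ?d \<omega>) + (?d \<omega>)\<^sup>2)"
    by (simp add: mart_def power2_eq_square algebra_simps)
  also have "\<dots> = expectation (\<lambda>\<omega>. (mart n \<omega>)\<^sup>2) + expectation (\<lambda>\<omega>. (?d \<omega>)\<^sup>2)"
    using int cross by simp
  finally show ?case using Suc sq by (simp add: algebra_simps)
qed

lemma mart_slln: "AE \<omega> in \<Omega>. (\<lambda>n. mart n \<omega> / real n) \<longlonglongrightarrow> 0"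
proof (rule bounded_increments_slln[OF mart_measurable K_nonneg])
  show "\<bar>mart (Suc n) \<omega> - mart n \<omega>\<bar> \<le> K" if "\<omega> \<in> space \<Omega>" for n \<omega>
    using d_bound X_in[OF that] by (simp add: mart_def)
  show "integrable \<Omega> (\<lambda>\<omega>. (mart n \<omega>)\<^sup>2)" for n
    using integrable_mart[of "\<lambda>m x y. m\<^sup>2" n] by simp
qed (rule mart_second_moment)

end

text \<open>The conditional variances are corrected by a bounded \<open>\<kappa>\<close> to deterministic values \<open>v\<close>.  Weighting
  the characteristic function of the martingale by \<open>1 - \<theta>\<^sup>2\<kappa>/2\<close> then makes it a product of the factors
  \<open>exp (- \<theta>\<^sup>2v/2)\<close> up to errors of order \<open>\<theta>\<^sup>3\<close> per step.\<close>

locale markov_martingale_clt = markov_martingale +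
  fixes \<kappa> :: "nat \<Rightarrow> 'a \<Rightarrow> real" and v :: "nat \<Rightarrow> real" and L \<sigma>2 V :: real
  assumes \<kappa>_bound: "x \<in> S \<Longrightarrow> \<bar>\<kappa> n x\<bar> \<le> L"
    and v_bound: "0 \<le> v n" "v n \<le> L"
    and \<kappa>_step: "x \<in> S \<Longrightarrow>
      (\<Sum>y\<in>S. Q n x y * (d n x y)\<^sup>2) + (\<Sum>y\<in>S. Q n x y * \<kappa> (Suc n) y) = v n + \<kappa> n x"
    and \<sigma>2_pos: "0 < \<sigma>2" and v_avg: "\<bar>(\<Sum>m<n. v m) - real n * \<sigma>2\<bar> \<le> V"
begin

definition weight :: "real \<Rightarrow> nat \<Rightarrow> 'a \<Rightarrow> complex"
  where "weight \<theta> n x = 1 - of_real (\<theta>\<^sup>2 / 2 * \<kappa> n x)"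

definition \<psi> :: "real \<Rightarrow> nat \<Rightarrow> complex"
  where "\<psi> \<theta> n = expectation (\<lambda>\<omega>. iexp (\<theta> * mart n \<omega>) * weight \<theta> n (X n \<omega>))"

text \<open>Coefficient of the cubic error of one step: \<open>K ^ 3\<close> from the Taylor
  remainder, \<open>L * K\<close> from corrector times increment, \<open>L\<^sup>2\<close> from
  replacing \<open>1 - a\<close> by \<open>exp (- a)\<close>.\<close>

definition D :: real
  where "D = K ^ 3 + L * K + L\<^sup>2"

lemma L_nonneg: "0 \<le> L"
  using v_bound by (rule order.trans)

text \<open>To second order the conditional mean is \<open>1 - a - b\<close>: the linear term
  averages to zero, and \<open>\<kappa>_step\<close> trades the state-dependent conditional variance
  for the constant \<open>v n\<close> and the present corrector. This is close to
  \<open>exp (- a) * (1 - b)\<close>, where \<open>1 - b\<close> is the present weight.\<close>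

lemma one_step:
  assumes x: "x \<in> S" and \<theta>: "\<bar>\<theta>\<bar> \<le> 1"
  shows "cmod ((\<Sum>y\<in>S. Q n x y *\<^sub>R (iexp (\<theta> * d n x y) * weight \<theta> (Suc n) y))
    - of_real (exp (- (\<theta>\<^sup>2 / 2 * v n))) * weight \<theta> n x) \<le> D * \<bar>\<theta>\<bar> ^ 3"
proof -
  define a b where "a = \<theta>\<^sup>2 / 2 * v n" and "b = \<theta>\<^sup>2 / 2 * \<kappa> n x"
  let ?lin = "\<lambda>y. 1 + \<i> * of_real (\<theta> * d n x y) - of_real ((\<theta> * d n x y)\<^sup>2 / 2 + \<theta>\<^sup>2 / 2 * \<kappa> (Suc n) y) :: complex"
  have Qn: "Q n x y \<ge> 0" if "y \<in> S" for y using stoch_nonneg[OF stoch x that] .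
  have Q1: "(\<Sum>y\<in>S. Q n x y) = 1" using stoch x by (simp add: stoch_def)
  have "(\<Sum>y\<in>S. Q n x y *\<^sub>R ?lin y) = of_real (\<Sum>y\<in>S. Q n x y) + \<i> * of_real \<theta> * of_real (\<Sum>y\<in>S. Q n x y * d n x y)
      - of_real (\<theta>\<^sup>2 / 2 * ((\<Sum>y\<in>S. Q n x y * (d n x y)\<^sup>2) + (\<Sum>y\<in>S. Q n x y * \<kappa> (Suc n) y)))"
    by (simp add: scaleR_conv_of_real algebra_simps sum.distrib sum_subtractf sum_distrib_left power_mult_distrib)
  also have "\<dots> = of_real (1 - a - b)"
    unfolding \<kappa>_step[OF x] d_mean[OF x] Q1 by (simp add: a_def b_def algebra_simps)
  finally have lin: "(\<Sum>y\<in>S. Q n x y *\<^sub>R ?lin y) = of_real (1 - a - b)" .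
  have t3: "\<theta>\<^sup>2 * \<bar>\<theta>\<bar> = \<bar>\<theta>\<bar> ^ 3" by (simp add: power2_eq_square power3_eq_cube)
  \<comment> \<open>Here \<open>\<bar>\<theta>\<bar> \<le> 1\<close> absorbs fourth-order errors
    into third-order ones.\<close>
  have t4: "\<theta>\<^sup>2 * \<theta>\<^sup>2 \<le> \<bar>\<theta>\<bar> ^ 3"
  proof -
    have "\<theta>\<^sup>2 * \<theta>\<^sup>2 = \<bar>\<theta>\<bar> ^ 3 * \<bar>\<theta>\<bar>" by (simp add: power2_eq_square power3_eq_cube)
    also have "\<dots> \<le> \<bar>\<theta>\<bar> ^ 3 * 1" using \<theta> by (intro mult_left_mono) auto
    finally show ?thesis by (simp only: mult_1_right)
  qed
  have y_bound: "cmod (iexp (\<theta> * d n x y) * weight \<theta> (Suc n) y - ?lin y) \<le> (K ^ 3 + L * K) * \<bar>\<theta>\<bar> ^ 3"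
    if y: "y \<in> S" for y
  proof -
    have "cmod (iexp (\<theta> * d n x y) * weight \<theta> (Suc n) y - ?lin y)
        \<le> \<bar>\<theta> * d n x y\<bar> ^ 3 / 6 + \<bar>\<theta>\<^sup>2 / 2 * \<kappa> (Suc n) y\<bar> * \<bar>\<theta> * d n x y\<bar>"
      unfolding weight_def by (rule iexp_perturbed_le)
    also have "\<dots> = \<bar>\<theta>\<bar> ^ 3 * (\<bar>d n x y\<bar> ^ 3 / 6 + \<bar>\<kappa> (Suc n) y\<bar> * \<bar>d n x y\<bar> / 2)"
    proof -
      have "\<bar>\<theta> * d n x y\<bar> ^ 3 = \<bar>\<theta>\<bar> ^ 3 * \<bar>d n x y\<bar> ^ 3"
        by (simp only: abs_mult power_mult_distrib)
      moreover have "\<bar>\<theta>\<^sup>2 / 2 * \<kappa> (Suc n) y\<bar> * \<bar>\<theta> * d n x y\<bar> = (\<theta>\<^sup>2 * \<bar>\<theta>\<bar>) * (\<bar>\<kappa> (Suc n) y\<bar> * \<bar>d n x y\<bar> / 2)"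
        by (simp add: abs_mult)
      ultimately show ?thesis by (simp only: t3 distrib_left times_divide_eq_right)
    qed
    also have "\<dots> \<le> \<bar>\<theta>\<bar> ^ 3 * (K ^ 3 + L * K)"
    proof (intro mult_left_mono add_mono)
      have "\<bar>d n x y\<bar> ^ 3 \<le> K ^ 3" using d_bound[OF x y] by (intro power_mono) auto
      then show "\<bar>d n x y\<bar> ^ 3 / 6 \<le> K ^ 3" using zero_le_power[OF K_nonneg, of 3] by linarith
      have "\<bar>\<kappa> (Suc n) y\<bar> * \<bar>d n x y\<bar> \<le> L * K"
        using d_bound[OF x y] \<kappa>_bound[OF y] L_nonneg by (intro mult_mono) auto
      then show "\<bar>\<kappa> (Suc n) y\<bar> * \<bar>d n x y\<bar> / 2 \<le> L * K"
        using mult_nonneg_nonneg[OF L_nonneg K_nonneg] by linarith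
    qed simp
    finally show ?thesis by (simp add: mult.commute)
  qed
  have "cmod ((\<Sum>y\<in>S. Q n x y *\<^sub>R (iexp (\<theta> * d n x y) * weight \<theta> (Suc n) y)) - of_real (1 - a - b))
      = cmod (\<Sum>y\<in>S. Q n x y *\<^sub>R (iexp (\<theta> * d n x y) * weight \<theta> (Suc n) y - ?lin y))"
    unfolding lin[symmetric] by (simp only: scaleR_diff_right sum_subtractf)
  also have "\<dots> \<le> (\<Sum>y\<in>S. Q n x y * ((K ^ 3 + L * K) * \<bar>\<theta>\<bar> ^ 3))"
    using Qn y_bound by (intro sum_norm_le) (auto intro: mult_left_mono)
  also have "\<dots> = (K ^ 3 + L * K) * \<bar>\<theta>\<bar> ^ 3" using Q1 by (simp flip: sum_distrib_right)
  finally have 1: "cmod ((\<Sum>y\<in>S. Q n x y *\<^sub>R (iexp (\<theta> * d n x y) * weight \<theta> (Suc n) y)) - of_real (1 - a - b))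
    \<le> (K ^ 3 + L * K) * \<bar>\<theta>\<bar> ^ 3" .
  have a: "0 \<le> a" "a \<le> \<theta>\<^sup>2 / 2 * L"
    using v_bound by (auto simp: a_def intro: mult_left_mono)
  have b: "\<bar>b\<bar> \<le> \<theta>\<^sup>2 / 2 * L"
    using \<kappa>_bound[OF x] by (auto simp: b_def abs_mult intro: mult_left_mono)
  \<comment> \<open>Both terms are products of two quantities of order
    \<open>\<theta>\<^sup>2\<close>; bounding \<open>a\<close> and \<open>\<bar>b\<bar>\<close> by
    \<open>\<theta>\<^sup>2 / 2 * L\<close> yields the factor 3/8 below.\<close>
  have "\<bar>(1 - a - b) - exp (- a) * (1 - b)\<bar> = \<bar>- (exp (- a) - (1 - a)) - b * (1 - exp (- a))\<bar>"
    by (simp add: algebra_simps)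
  also have "\<dots> \<le> \<bar>exp (- a) - (1 - a)\<bar> + \<bar>b\<bar> * \<bar>1 - exp (- a)\<bar>"
    using abs_triangle_ineq4[of "- (exp (- a) - (1 - a))" "b * (1 - exp (- a))"] by (simp only: abs_mult abs_minus_cancel)
  also have "\<dots> \<le> a\<^sup>2 / 2 + \<bar>b\<bar> * a"
    using exp_minus_bounds[OF a(1)] by (intro add_mono mult_left_mono) auto
  also have "\<dots> \<le> (\<theta>\<^sup>2 / 2 * L)\<^sup>2 / 2 + (\<theta>\<^sup>2 / 2 * L) * (\<theta>\<^sup>2 / 2 * L)"
    using a b by (intro add_mono mult_mono divide_right_mono power_mono) auto
  also have "\<dots> = 3 / 8 * L\<^sup>2 * (\<theta>\<^sup>2 * \<theta>\<^sup>2)" by (simp add: power2_eq_square)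
  also have "\<dots> \<le> L\<^sup>2 * \<bar>\<theta>\<bar> ^ 3"
    using t4 by (intro mult_mono) auto
  finally have real: "\<bar>(1 - a - b) - exp (- a) * (1 - b)\<bar> \<le> L\<^sup>2 * \<bar>\<theta>\<bar> ^ 3" .
  have 2: "cmod (of_real (1 - a - b) - of_real (exp (- a)) * weight \<theta> n x) \<le> L\<^sup>2 * \<bar>\<theta>\<bar> ^ 3"
  proof -
    have "of_real (1 - a - b) - of_real (exp (- a)) * weight \<theta> n x
        = (of_real (1 - a - b - exp (- a) * (1 - b)) :: complex)"
      by (simp add: weight_def b_def)
    then show ?thesis
      using real by (simp only: norm_of_real)
  qed
  have "(K ^ 3 + L * K) * \<bar>\<theta>\<bar> ^ 3 + L\<^sup>2 * \<bar>\<theta>\<bar> ^ 3 = D * \<bar>\<theta>\<bar> ^ 3"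
    by (simp only: D_def distrib_right)
  then show ?thesis
    unfolding a_def[symmetric]
    using norm_triangle_le[OF add_mono[OF 1 2]] by (simp only: add_diff_eq diff_add_cancel)
qed

text \<open>The factor from the past, \<open>iexp (\<theta> * mart n \<omega>)\<close>, has modulus
  1, so the pointwise bound \<open>one_step\<close> passes to the expectation.\<close>

lemma \<psi>_step:
  assumes \<theta>: "\<bar>\<theta>\<bar> \<le> 1"
  shows "cmod (\<psi> \<theta> (Suc n) - of_real (exp (- (\<theta>\<^sup>2 / 2 * v n))) * \<psi> \<theta> n) \<le> D * \<bar>\<theta>\<bar> ^ 3"
proof -
  define G where "G = (\<lambda>x y. iexp (\<theta> * d n x y) * weight \<theta> (Suc n) y)"
  define A where "A = (\<lambda>m x. iexp (\<theta> * m) * (\<Sum>y\<in>S. Q n x y *\<^sub>R G x y))"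
  define B where "B = (\<lambda>m x. of_real (exp (- (\<theta>\<^sup>2 / 2 * v n))) * (iexp (\<theta> * m) * weight \<theta> n x))"
  have int: "integrable \<Omega> (\<lambda>\<omega>. A (mart n \<omega>) (X n \<omega>))" "integrable \<Omega> (\<lambda>\<omega>. B (mart n \<omega>) (X n \<omega>))"
    using integrable_mart[of "\<lambda>m x y. A m x" n] integrable_mart[of "\<lambda>m x y. B m x" n] by auto
  have "\<psi> \<theta> (Suc n) = expectation (\<lambda>\<omega>. iexp (\<theta> * mart n \<omega>) * G (X n \<omega>) (X (Suc n) \<omega>))"
    unfolding \<psi>_def by (simp add: G_def mart_def ring_distribs exp_add mult.assoc)
  also have "\<dots> = expectation (\<lambda>\<omega>. A (mart n \<omega>) (X n \<omega>))"
    unfolding A_def by (rule mart_step)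
  finally have "\<psi> \<theta> (Suc n) - of_real (exp (- (\<theta>\<^sup>2 / 2 * v n))) * \<psi> \<theta> n
      = expectation (\<lambda>\<omega>. A (mart n \<omega>) (X n \<omega>)) - expectation (\<lambda>\<omega>. B (mart n \<omega>) (X n \<omega>))"
    by (simp add: \<psi>_def B_def)
  also have "\<dots> = expectation (\<lambda>\<omega>. A (mart n \<omega>) (X n \<omega>) - B (mart n \<omega>) (X n \<omega>))"
    using int by simp
  also have "cmod \<dots> \<le> expectation (\<lambda>\<omega>. cmod (A (mart n \<omega>) (X n \<omega>) - B (mart n \<omega>) (X n \<omega>)))"
    by (rule integral_norm_bound)
  also have "\<dots> \<le> expectation (\<lambda>\<omega>. D * \<bar>\<theta>\<bar> ^ 3)"
  proof (intro integral_mono integrable_norm Bochner_Integration.integrable_diff int)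
    fix \<omega> assume \<omega>: "\<omega> \<in> space \<Omega>"
    have "A (mart n \<omega>) (X n \<omega>) - B (mart n \<omega>) (X n \<omega>) = iexp (\<theta> * mart n \<omega>) *
      ((\<Sum>y\<in>S. Q n (X n \<omega>) y *\<^sub>R G (X n \<omega>) y) - of_real (exp (- (\<theta>\<^sup>2 / 2 * v n))) * weight \<theta> n (X n \<omega>))"
      by (simp add: A_def B_def algebra_simps)
    then show "cmod (A (mart n \<omega>) (X n \<omega>) - B (mart n \<omega>) (X n \<omega>)) \<le> D * \<bar>\<theta>\<bar> ^ 3"
      using one_step[OF X_in[OF \<omega>] \<theta>, of n n] by (simp only: norm_mult norm_exp_i_times G_def mult_1)
  qed simp
  finally show ?thesis by (simp add: prob_space)
qed

text \<open>Since \<open>v\<close> is nonnegative, every exponential factor is at most 1, and the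
  errors of the steps merely add up.\<close>

lemma \<psi>_product:
  assumes \<theta>: "\<bar>\<theta>\<bar> \<le> 1"
  shows "cmod (\<psi> \<theta> n - of_real (exp (- (\<theta>\<^sup>2 / 2 * (\<Sum>m<n. v m)))) * \<psi> \<theta> 0) \<le> real n * (D * \<bar>\<theta>\<bar> ^ 3)"
proof (induction n)
  case (Suc n)
  let ?e = "of_real (exp (- (\<theta>\<^sup>2 / 2 * v n))) :: complex"
  let ?p = "of_real (exp (- (\<theta>\<^sup>2 / 2 * (\<Sum>m<n. v m)))) * \<psi> \<theta> 0"
  have "exp (- (\<theta>\<^sup>2 / 2 * (\<Sum>m<Suc n. v m))) = exp (- (\<theta>\<^sup>2 / 2 * v n)) * exp (- (\<theta>\<^sup>2 / 2 * (\<Sum>m<n. v m)))"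
    by (simp add: algebra_simps flip: exp_add)
  then have "of_real (exp (- (\<theta>\<^sup>2 / 2 * (\<Sum>m<Suc n. v m)))) * \<psi> \<theta> 0 = ?e * ?p"
    by (simp only: of_real_mult mult.assoc)
  then have eq: "\<psi> \<theta> (Suc n) - of_real (exp (- (\<theta>\<^sup>2 / 2 * (\<Sum>m<Suc n. v m)))) * \<psi> \<theta> 0
      = (\<psi> \<theta> (Suc n) - ?e * \<psi> \<theta> n) + ?e * (\<psi> \<theta> n - ?p)"
    by (simp only: right_diff_distrib) simp
  have "cmod (?e * (\<psi> \<theta> n - ?p)) \<le> 1 * (real n * (D * \<bar>\<theta>\<bar> ^ 3))"
    unfolding norm_mult using Suc v_bound(1)[of n] by (intro mult_mono) auto
  then show ?case
    unfolding eq using \<psi>_step[OF \<theta>, of n]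
    by (intro norm_triangle_le) (simp add: ring_distribs)
qed simp

lemma weight_close: "x \<in> S \<Longrightarrow> cmod (weight \<theta> n x - 1) \<le> \<theta>\<^sup>2 / 2 * L"
  using \<kappa>_bound[of x n] by (auto simp: weight_def norm_mult norm_power intro: mult_left_mono)

lemma \<psi>_close: "cmod (expectation (\<lambda>\<omega>. iexp (\<theta> * mart n \<omega>)) - \<psi> \<theta> n) \<le> \<theta>\<^sup>2 / 2 * L"
proof -
  have int: "integrable \<Omega> (\<lambda>\<omega>. iexp (\<theta> * mart n \<omega>))"
    "integrable \<Omega> (\<lambda>\<omega>. iexp (\<theta> * mart n \<omega>) * weight \<theta> n (X n \<omega>))"
    using integrable_mart[of "\<lambda>m x y. iexp (\<theta> * m)" n]
      integrable_mart[of "\<lambda>m x y. iexp (\<theta> * m) * weight \<theta> n x" n] by auto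
  have "expectation (\<lambda>\<omega>. iexp (\<theta> * mart n \<omega>)) - \<psi> \<theta> n
      = expectation (\<lambda>\<omega>. iexp (\<theta> * mart n \<omega>) - iexp (\<theta> * mart n \<omega>) * weight \<theta> n (X n \<omega>))"
    unfolding \<psi>_def using int by simp
  also have "cmod \<dots> \<le> expectation (\<lambda>\<omega>. cmod (iexp (\<theta> * mart n \<omega>) - iexp (\<theta> * mart n \<omega>) * weight \<theta> n (X n \<omega>)))"
    by (rule integral_norm_bound)
  also have "\<dots> \<le> expectation (\<lambda>\<omega>. \<theta>\<^sup>2 / 2 * L)"
  proof (intro integral_mono integrable_norm Bochner_Integration.integrable_diff int)
    fix \<omega> assume \<omega>: "\<omega> \<in> space \<Omega>"
    have "iexp (\<theta> * mart n \<omega>) - iexp (\<theta> * mart n \<omega>) * weight \<theta> n (X n \<omega>)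
        = - (iexp (\<theta> * mart n \<omega>) * (weight \<theta> n (X n \<omega>) - 1))" by (simp add: algebra_simps)
    then show "cmod (iexp (\<theta> * mart n \<omega>) - iexp (\<theta> * mart n \<omega>) * weight \<theta> n (X n \<omega>)) \<le> \<theta>\<^sup>2 / 2 * L"
      using weight_close[OF X_in[OF \<omega>], of \<theta> n n]
      by (simp only: norm_minus_cancel norm_mult norm_exp_i_times mult_1)
  qed simp
  finally show ?thesis by (simp add: prob_space)
qed

text \<open>The term \<open>\<theta>\<^sup>2 * L\<close> is paid in two halves, for removing the
  weight at time \<open>n\<close> and at time 0.\<close>

lemma mart_char_close:
  assumes \<theta>: "\<bar>\<theta>\<bar> \<le> 1"
  shows "cmod (expectation (\<lambda>\<omega>. iexp (\<theta> * mart n \<omega>)) - of_real (exp (- (\<theta>\<^sup>2 / 2 * (\<Sum>m<n. v m)))))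
    \<le> real n * (D * \<bar>\<theta>\<bar> ^ 3) + \<theta>\<^sup>2 * L"
proof -
  let ?e = "of_real (exp (- (\<theta>\<^sup>2 / 2 * (\<Sum>m<n. v m)))) :: complex"
  have 0: "cmod (\<psi> \<theta> 0 - 1) \<le> \<theta>\<^sup>2 / 2 * L"
    using \<psi>_close[of \<theta> 0] by (simp add: mart_def prob_space norm_minus_commute)
  have "0 \<le> \<theta>\<^sup>2 / 2 * (\<Sum>m<n. v m)"
    by (intro mult_nonneg_nonneg sum_nonneg v_bound(1)) simp
  then have "cmod ?e \<le> 1" by simp
  from mult_mono[OF this 0] have "cmod (?e * (\<psi> \<theta> 0 - 1)) \<le> \<theta>\<^sup>2 / 2 * L"
    by (simp add: norm_mult)
  from norm_diff_chain[OF \<psi>_close \<psi>_product[OF \<theta>] this]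
  have "cmod (expectation (\<lambda>\<omega>. iexp (\<theta> * mart n \<omega>)) - ?e)
      \<le> \<theta>\<^sup>2 / 2 * L + (real n * (D * \<bar>\<theta>\<bar> ^ 3) + \<theta>\<^sup>2 / 2 * L)" .
  then show ?thesis by linarith
qed

text \<open>With \<open>\<theta> = t / sqrt (n * \<sigma>2)\<close> the product
  \<open>n * \<theta>\<^sup>2\<close> is constant for \<open>n > 0\<close>. The accumulated cubic
  errors, the weights and the bounded distance \<open>B\<close> then vanish with
  \<open>\<theta>\<close>, while \<open>v_avg\<close> makes the exponent converge to
  \<open>- t\<^sup>2 / 2\<close>.\<close>

theorem mart_clt:
  fixes Y :: "nat \<Rightarrow> 'b \<Rightarrow> real"
  assumes Y [measurable]: "\<And>n. Y n \<in> borel_measurable \<Omega>"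
    and close: "\<And>n \<omega>. \<omega> \<in> space \<Omega> \<Longrightarrow> \<bar>Y n \<omega> - mart n \<omega>\<bar> \<le> B"
  shows "weak_conv_m (\<lambda>n. distr \<Omega> borel (\<lambda>\<omega>. Y n \<omega> / sqrt (real n * \<sigma>2))) std_normal_distribution"
proof (rule levy_continuity)
  show "real_distribution (distr \<Omega> borel (\<lambda>\<omega>. Y n \<omega> / sqrt (real n * \<sigma>2)))" for n
    by (intro real_distribution_distr) measurable
  show "real_distribution std_normal_distribution" by (rule real_dist_normal_dist)
  fix t :: real
  define \<theta> where "\<theta> n = t / sqrt (real n * \<sigma>2)" for n
  have char: "char (distr \<Omega> borel (\<lambda>\<omega>. Y n \<omega> / sqrt (real n * \<sigma>2))) t
      = expectation (\<lambda>\<omega>. iexp (\<theta> n * Y n \<omega>))" for n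
    unfolding char_def \<theta>_def by (subst integral_distr) (auto simp: mult.commute)
  have \<theta>_0: "\<theta> \<longlonglongrightarrow> 0"
  proof -
    have "filterlim (\<lambda>n. \<sigma>2 * real n) at_top sequentially"
      by (rule filterlim_tendsto_pos_mult_at_top[OF tendsto_const \<sigma>2_pos filterlim_real_sequentially])
    then have "filterlim (\<lambda>n. sqrt (real n * \<sigma>2)) at_top sequentially"
      unfolding mult.commute[of \<sigma>2] by (rule filterlim_compose[OF sqrt_at_top])
    then show ?thesis
      unfolding \<theta>_def by (intro real_tendsto_divide_at_top[OF tendsto_const])
  qed
  have \<theta>_sq: "real n * (\<theta> n)\<^sup>2 = t\<^sup>2 / \<sigma>2" if "n > 0" for n
    using that \<sigma>2_pos by (simp add: \<theta>_def power_divide)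
  have Yint: "integrable \<Omega> (\<lambda>\<omega>. iexp (\<theta> n * Y n \<omega>))" for n
    by (intro integrable_const_bound[of _ 1]) auto
  have Y_close: "cmod (expectation (\<lambda>\<omega>. iexp (\<theta> n * Y n \<omega>)) - expectation (\<lambda>\<omega>. iexp (\<theta> n * mart n \<omega>)))
      \<le> \<bar>\<theta> n\<bar> * B" for n
  proof -
    have int: "integrable \<Omega> (\<lambda>\<omega>. iexp (\<theta> n * mart n \<omega>))"
      using integrable_mart[of "\<lambda>m x y. iexp (\<theta> n * m)" n] by simp
    have "expectation (\<lambda>\<omega>. iexp (\<theta> n * Y n \<omega>)) - expectation (\<lambda>\<omega>. iexp (\<theta> n * mart n \<omega>))
        = expectation (\<lambda>\<omega>. iexp (\<theta> n * Y n \<omega>) - iexp (\<theta> n * mart n \<omega>))"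
      using int Yint by simp
    also have "cmod \<dots> \<le> expectation (\<lambda>\<omega>. cmod (iexp (\<theta> n * Y n \<omega>) - iexp (\<theta> n * mart n \<omega>)))"
      by (rule integral_norm_bound)
    also have "\<dots> \<le> expectation (\<lambda>\<omega>. \<bar>\<theta> n\<bar> * B)"
    proof (intro integral_mono integrable_norm Bochner_Integration.integrable_diff int Yint)
      fix \<omega> assume \<omega>: "\<omega> \<in> space \<Omega>"
      let ?a = "\<theta> n * Y n \<omega>" and ?b = "\<theta> n * mart n \<omega>"
      have "iexp ?a - iexp ?b = iexp ?b * (iexp (?a - ?b) - 1)"
        by (simp add: algebra_simps flip: exp_add)
      then have "cmod (iexp ?a - iexp ?b) = cmod (iexp (?a - ?b) - 1)"
        by (simp only: norm_mult norm_exp_i_times mult_1)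
      also have "\<dots> \<le> \<bar>?a - ?b\<bar>" using iexp_approx1[of "?a - ?b" 0] by simp
      also have "\<dots> = \<bar>\<theta> n\<bar> * \<bar>Y n \<omega> - mart n \<omega>\<bar>" by (simp add: abs_mult flip: right_diff_distrib)
      also have "\<dots> \<le> \<bar>\<theta> n\<bar> * B" using close[OF \<omega>] by (intro mult_left_mono) auto
      finally show "cmod (iexp ?a - iexp ?b) \<le> \<bar>\<theta> n\<bar> * B" .
    qed simp
    finally show ?thesis by (simp add: prob_space)
  qed
  define g where "g n = exp (- ((\<theta> n)\<^sup>2 / 2 * (\<Sum>m<n. v m)))" for n
  have "(\<lambda>n. (\<Sum>m<n. v m) / real n - \<sigma>2) \<longlonglongrightarrow> 0"
  proof (rule Lim_null_comparison)
    show "\<forall>\<^sub>F n in sequentially. norm ((\<Sum>m<n. v m) / real n - \<sigma>2) \<le> V / real n"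
    proof (rule eventually_sequentiallyI[of 1])
      fix n :: nat assume n: "1 \<le> n"
      then have "(\<Sum>m<n. v m) / real n - \<sigma>2 = ((\<Sum>m<n. v m) - real n * \<sigma>2) / real n"
        by (simp add: field_simps)
      then show "norm ((\<Sum>m<n. v m) / real n - \<sigma>2) \<le> V / real n"
        using v_avg[of n] by (simp add: divide_right_mono)
    qed
  qed (rule lim_const_over_n)
  then have avg: "(\<lambda>n. (\<Sum>m<n. v m) / real n) \<longlonglongrightarrow> \<sigma>2"
    by (simp add: LIM_zero_iff)
  have "(\<lambda>n. exp (- (t\<^sup>2 / \<sigma>2 / 2 * ((\<Sum>m<n. v m) / real n)))) \<longlonglongrightarrow> exp (- (t\<^sup>2 / \<sigma>2 / 2 * \<sigma>2))"
    by (intro tendsto_intros avg)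
  moreover have "\<forall>\<^sub>F n in sequentially. exp (- (t\<^sup>2 / \<sigma>2 / 2 * ((\<Sum>m<n. v m) / real n))) = g n"
    using eventually_gt_at_top[of 0]
    by eventually_elim (simp add: g_def field_simps flip: \<theta>_sq)
  ultimately have "g \<longlonglongrightarrow> exp (- (t\<^sup>2 / \<sigma>2 / 2 * \<sigma>2))"
    by (rule Lim_transform_eventually)
  then have g_lim: "g \<longlonglongrightarrow> exp (- (t\<^sup>2) / 2)"
    using \<sigma>2_pos by simp
  have "(\<lambda>n. expectation (\<lambda>\<omega>. iexp (\<theta> n * Y n \<omega>)) - of_real (g n)) \<longlonglongrightarrow> 0"
  proof (rule Lim_null_comparison)
    let ?b = "\<lambda>n. \<bar>\<theta> n\<bar> * B + (t\<^sup>2 / \<sigma>2 * (D * \<bar>\<theta> n\<bar>) + (\<theta> n)\<^sup>2 * L)"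
    have abs: "(\<lambda>n. \<bar>\<theta> n\<bar>) \<longlonglongrightarrow> 0"
      using \<theta>_0 by (rule tendsto_rabs_zero)
    have sq: "(\<lambda>n. (\<theta> n)\<^sup>2) \<longlonglongrightarrow> 0"
      using tendsto_power[OF \<theta>_0, of 2] by simp
    show "?b \<longlonglongrightarrow> 0"
      by (intro tendsto_add_zero tendsto_mult_left_zero tendsto_mult_right_zero abs sq)
    have "\<forall>\<^sub>F n in sequentially. \<bar>\<theta> n\<bar> < 1"
      using tendstoD[OF \<theta>_0, of 1] by simp
    with eventually_gt_at_top[of 0]
    show "\<forall>\<^sub>F n in sequentially. norm (expectation (\<lambda>\<omega>. iexp (\<theta> n * Y n \<omega>)) - of_real (g n)) \<le> ?b n"
    proof eventually_elim
      case (elim n)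
      have "real n * (D * \<bar>\<theta> n\<bar> ^ 3) = (real n * (\<theta> n)\<^sup>2) * (D * \<bar>\<theta> n\<bar>)"
        by (simp add: power2_eq_square power3_eq_cube)
      then have mart: "cmod (expectation (\<lambda>\<omega>. iexp (\<theta> n * mart n \<omega>)) - of_real (g n))
          \<le> t\<^sup>2 / \<sigma>2 * (D * \<bar>\<theta> n\<bar>) + (\<theta> n)\<^sup>2 * L"
        using mart_char_close[of "\<theta> n" n] elim by (simp only: \<theta>_sq g_def less_imp_le)
      define p q where "p = expectation (\<lambda>\<omega>. iexp (\<theta> n * Y n \<omega>))"
        and "q = expectation (\<lambda>\<omega>. iexp (\<theta> n * mart n \<omega>))"
      have "p - of_real (g n) = (p - q) + (q - of_real (g n))" by simp
      then show ?case
        unfolding p_def[symmetric]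
        using norm_triangle_le[OF add_mono[OF Y_close[of n] mart]] by (simp only: p_def q_def)
    qed
  qed
  from tendsto_add[OF this tendsto_of_real[OF g_lim]]
  show "(\<lambda>n. char (distr \<Omega> borel (\<lambda>\<omega>. Y n \<omega> / sqrt (real n * \<sigma>2))) t) \<longlonglongrightarrow> char std_normal_distribution t"
    by (simp add: char char_std_normal_distribution)
qed

end

section \<open>Payoffs along a periodic chain\<close>

text \<open>In the second case the next phase is called \<open>T\<close> or 0, depending on whether
  the reduction comes before or after the successor.\<close>

lemma Suc_mod_cases:
  assumes "0 < (T::nat)"
  obtains "Suc n mod T = Suc (n mod T)" "Suc (n mod T) < T" | "Suc n mod T = 0" "Suc (n mod T) = T"
  using assms mod_Suc[of n T] mod_less_divisor[of T n] by (metis Suc_lessI)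

lemma finite_bound:
  fixes f :: "'a \<Rightarrow> real"
  assumes "finite A"
  shows "\<exists>K. \<forall>a\<in>A. \<bar>f a\<bar> \<le> K"
proof -
  have "bdd_above ((\<lambda>a. \<bar>f a\<bar>) ` A)" using assms by simp
  then show ?thesis unfolding bdd_above_def by auto
qed

text \<open>Partial sums of the centred values vanish over a full period, so the deviation is itself
  periodic and takes finitely many values.\<close>

lemma periodic_average:
  fixes a :: "nat \<Rightarrow> real"
  assumes T: "0 < T"
  shows "\<exists>V. \<forall>n. \<bar>(\<Sum>k<n. a (k mod T)) - real n * ((\<Sum>k<T. a k) / real T)\<bar> \<le> V"
proof -
  define m where "m = (\<Sum>k<T. a k) / real T"
  define b where "b n = (\<Sum>k<n. a k - m)" for n
  have bT: "b T = 0" using T by (simp add: b_def m_def sum_subtractf)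
  have eq: "(\<Sum>k<n. a (k mod T)) - real n * m = b (n mod T)" for n
  proof (induction n)
    case 0
    then show ?case by (simp add: b_def)
  next
    case (Suc n)
    have "b (Suc (n mod T)) = b (Suc n mod T)"
      by (rule Suc_mod_cases[OF T, of n]) (auto simp: bT, simp add: b_def)
    then show ?case using Suc by (simp add: algebra_simps) (simp add: b_def algebra_simps)
  qed
  obtain V where V: "\<forall>k\<in>{..<T}. \<bar>b k\<bar> \<le> V" using finite_bound[of "{..<T}" b] by auto
  have "\<bar>b (n mod T)\<bar> \<le> V" for n using V T by simp
  then show ?thesis unfolding m_def[symmetric] eq by blast
qed

locale periodic_chain = periodic_payoff S C Q T P \<pi> W + finite_markov_chain S \<Omega> Q X
  for S C :: "'a set" and Q T P \<pi> W and \<Omega> :: "'w measure" and X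
begin

definition mean :: real
  where "mean = (\<Sum>k<T. E k (drift k)) / real T"

definition asymptotic_variance :: real
  where "asymptotic_variance = (\<Sum>k<T. E k (increment_var k)) / real T"

lemma uniform_bound:
  fixes f :: "nat \<Rightarrow> 'a \<Rightarrow> real"
  shows "\<exists>K. \<forall>n. \<forall>x\<in>S. \<bar>f (n mod T) x\<bar> \<le> K"
proof -
  obtain K where K: "\<forall>a\<in>{..<T} \<times> S. \<bar>case_prod f a\<bar> \<le> K"
    using finite_bound[of "{..<T} \<times> S" "case_prod f"] finite_S by auto
  then show ?thesis using T_pos by (intro exI[of _ K]) auto
qed

lemma increment_bounded:
  "\<exists>K. \<forall>n. \<forall>x\<in>S. \<forall>y\<in>S. \<bar>increment (n mod T) x y\<bar> \<le> K"
proof -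
  let ?f = "\<lambda>(k, x, y). increment k x y"
  obtain K where K: "\<forall>a\<in>{..<T} \<times> S \<times> S. \<bar>?f a\<bar> \<le> K"
    using finite_bound[of "{..<T} \<times> S \<times> S" ?f] finite_S by auto
  then show ?thesis using T_pos by (intro exI[of _ K]) auto
qed

text \<open>Both names of the next phase give the same corrector; the boundary case is
  \<open>poisson_wrap\<close>.\<close>

lemma poisson_mod_Suc:
  assumes "x \<in> S"
  shows "poisson f (Suc (n mod T)) x = poisson f (Suc n mod T) x"
  by (rule Suc_mod_cases[OF T_pos, of n]) (use assms in \<open>auto simp: poisson_wrap\<close>)

lemma martingale:
  assumes "\<forall>n. \<forall>x\<in>S. \<forall>y\<in>S. \<bar>increment (n mod T) x y\<bar> \<le> K"
  shows "markov_martingale S \<Omega> Q X (\<lambda>n. increment (n mod T)) K"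
proof
  show "(\<Sum>y\<in>S. Q n x y * increment (n mod T) x y) = 0" if "x \<in> S" for n x
    using increment_mean[of "n mod T" x] T_pos that by (simp add: Q_mod)
qed (use assms in \<open>auto intro: stoch_Q\<close>)

text \<open>Along a path the correctors telescope, also across period boundaries.\<close>

lemma payoff_sum_decomposition:
  assumes \<omega>: "\<omega> \<in> space \<Omega>"
  shows "(\<Sum>k<n. W (X k \<omega>) (X (Suc k) \<omega>)) = (\<Sum>k<n. increment (k mod T) (X k \<omega>) (X (Suc k) \<omega>))
    + (\<Sum>k<n. E (k mod T) (drift (k mod T)))
    - poisson drift (n mod T) (X n \<omega>) + poisson drift 0 (X 0 \<omega>)"
  by (induction n) (simp_all add: increment_def poisson_mod_Suc[OF X_in[OF \<omega>]])

lemma payoff_sum_close: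
  "\<exists>B. \<forall>n. \<forall>\<omega>\<in>space \<Omega>. \<bar>(\<Sum>k<n. W (X k \<omega>) (X (Suc k) \<omega>)) - real n * mean
    - (\<Sum>k<n. increment (k mod T) (X k \<omega>) (X (Suc k) \<omega>))\<bar> \<le> B"
proof -
  obtain V where V: "\<And>n. \<bar>(\<Sum>k<n. E (k mod T) (drift (k mod T))) - real n * mean\<bar> \<le> V"
    using periodic_average[OF T_pos, of "\<lambda>k. E k (drift k)"] unfolding mean_def by blast
  obtain K where K: "\<And>n x. x \<in> S \<Longrightarrow> \<bar>poisson drift (n mod T) x\<bar> \<le> K"
    using uniform_bound[of "poisson drift"] by blast
  have "\<bar>(\<Sum>k<n. W (X k \<omega>) (X (Suc k) \<omega>)) - real n * mean
    - (\<Sum>k<n. increment (k mod T) (X k \<omega>) (X (Suc k) \<omega>))\<bar> \<le> V + K + K" if \<omega>: "\<omega> \<in> space \<Omega>" for n \<omega>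
    using payoff_sum_decomposition[OF \<omega>, of n] V[of n] K[OF X_in[OF \<omega>, of n], of n]
      K[OF X_in[OF \<omega>, of 0], of 0] by simp
  then show ?thesis by blast
qed

theorem payoff_slln:
  "AE \<omega> in \<Omega>. (\<lambda>n. (\<Sum>k<n. W (X k \<omega>) (X (Suc k) \<omega>)) / real n) \<longlonglongrightarrow> mean"
proof -
  obtain K where K: "\<forall>n. \<forall>x\<in>S. \<forall>y\<in>S. \<bar>increment (n mod T) x y\<bar> \<le> K"
    using increment_bounded by blast
  interpret M: markov_martingale S \<Omega> Q X "\<lambda>n. increment (n mod T)" K by (rule martingale[OF K])
  obtain B where B: "\<And>n \<omega>. \<omega> \<in> space \<Omega> \<Longrightarrow>
      \<bar>(\<Sum>k<n. W (X k \<omega>) (X (Suc k) \<omega>)) - real n * mean - M.mart n \<omega>\<bar> \<le> B"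
    using payoff_sum_close unfolding M.mart_def by blast
  show ?thesis
    using AE_space M.mart_slln
  proof eventually_elim
    case (elim \<omega>)
    let ?Y = "\<lambda>n. (\<Sum>k<n. W (X k \<omega>) (X (Suc k) \<omega>))"
    have "(\<lambda>n. (?Y n - real n * mean - M.mart n \<omega>) / real n) \<longlonglongrightarrow> 0"
      using B[OF elim(1)]
      by (intro Lim_null_comparison[OF _ lim_const_over_n[of B]] always_eventually allI)
        (simp add: divide_right_mono)
    from tendsto_add[OF tendsto_add[OF this elim(2)] tendsto_const[of mean]]
    have "(\<lambda>n. (?Y n - real n * mean - M.mart n \<omega>) / real n + M.mart n \<omega> / real n + mean) \<longlonglongrightarrow> mean"
      by simp
    moreover have "\<forall>\<^sub>F n in sequentially.
      (?Y n - real n * mean - M.mart n \<omega>) / real n + M.mart n \<omega> / real n + mean = ?Y n / real n"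
      using eventually_gt_at_top[of 0] by eventually_elim (simp add: field_simps)
    ultimately show ?case by (rule Lim_transform_eventually)
  qed
qed

theorem payoff_clt:
  assumes "0 < asymptotic_variance"
  shows "weak_conv_m (\<lambda>n. distr \<Omega> borel (\<lambda>\<omega>. ((\<Sum>k<n. W (X k \<omega>) (X (Suc k) \<omega>)) - real n * mean)
    / sqrt (real n * asymptotic_variance))) std_normal_distribution"
proof -
  define v where "v n = E (n mod T) (increment_var (n mod T))" for n
  obtain K where K: "\<forall>n. \<forall>x\<in>S. \<forall>y\<in>S. \<bar>increment (n mod T) x y\<bar> \<le> K"
    using increment_bounded by blast
  interpret M: markov_martingale S \<Omega> Q X "\<lambda>n. increment (n mod T)" K by (rule martingale[OF K])
  obtain B where B: "\<And>n \<omega>. \<omega> \<in> space \<Omega> \<Longrightarrow>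
      \<bar>(\<Sum>k<n. W (X k \<omega>) (X (Suc k) \<omega>)) - real n * mean - M.mart n \<omega>\<bar> \<le> B"
    using payoff_sum_close unfolding M.mart_def by blast
  obtain V where V: "\<And>n. \<bar>(\<Sum>k<n. v k) - real n * asymptotic_variance\<bar> \<le> V"
    using periodic_average[OF T_pos, of "\<lambda>k. E k (increment_var k)"]
    unfolding asymptotic_variance_def v_def by blast
  obtain L1 where L1: "\<And>n x. x \<in> S \<Longrightarrow> \<bar>poisson increment_var (n mod T) x\<bar> \<le> L1"
    using uniform_bound[of "poisson increment_var"] by blast
  \<comment> \<open>The bound comes from a lemma on functions of phase and state, here constant in
    the state; \<open>x0\<close> is only a point at which to read it.\<close>
  obtain L2 where L2: "\<And>n x. x \<in> S \<Longrightarrow> \<bar>E (n mod T) (increment_var (n mod T))\<bar> \<le> L2"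
    using uniform_bound[of "\<lambda>k x. E k (increment_var k)"] by blast
  obtain x0 where x0: "x0 \<in> S" using S_ne by blast
  have meas: "(\<lambda>\<omega>. (\<Sum>k<n. W (X k \<omega>) (X (Suc k) \<omega>)) - real n * mean) \<in> borel_measurable \<Omega>" for n
    using hist_integrable[of "\<lambda>h. (\<Sum>k<n. W (h k) (h (Suc k))) - real n * mean" n]
    by (intro borel_measurable_integrable) (simp add: hist_def)
  \<comment> \<open>The same corrector construction, now fed with the conditional variances instead
    of the drifts, supplies \<open>\<kappa>\<close>; \<open>max L1 L2\<close> bounds both it and
    \<open>v\<close>.\<close>
  interpret markov_martingale_clt S \<Omega> Q X "\<lambda>n. increment (n mod T)" K
    "\<lambda>n. poisson increment_var (n mod T)" v "max L1 L2" asymptotic_variance V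
  proof
    fix n
    show "\<bar>poisson increment_var (n mod T) x\<bar> \<le> max L1 L2" if "x \<in> S" for x
      using L1[OF that, of n] by simp
    show "0 \<le> v n"
      unfolding v_def increment_var_def using stoch_Q
      by (intro E_nonneg) (auto simp: stoch_def intro!: sum_nonneg mult_nonneg_nonneg)
    show "v n \<le> max L1 L2" using L2[OF x0, of n] by (simp add: v_def)
    show "(\<Sum>y\<in>S. Q n x y * (increment (n mod T) x y)\<^sup>2)
        + (\<Sum>y\<in>S. Q n x y * poisson increment_var (Suc n mod T) y) = v n + poisson increment_var (n mod T) x"
      if x: "x \<in> S" for x
    proof -
      have "(\<Sum>y\<in>S. Q n x y * poisson increment_var (Suc n mod T) y)
          = mv S (Q (n mod T)) (poisson increment_var (Suc (n mod T))) x"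
        by (simp add: mv_def Q_mod poisson_mod_Suc)
      then show ?thesis
        using poisson_step[of "n mod T" increment_var x] T_pos
        by (simp add: v_def increment_var_def[of "n mod T"] Q_mod)
    qed
  qed (use assms V in auto)
  show ?thesis by (rule mart_clt[OF meas B])
qed

end

section \<open>The parameters of a pattern\<close>

definition pattern_kernel ::
    "('a \<Rightarrow> 'a \<Rightarrow> real) \<Rightarrow> ('a \<Rightarrow> 'a \<Rightarrow> real) \<Rightarrow> nat \<Rightarrow> nat \<Rightarrow> nat \<Rightarrow> 'a \<Rightarrow> 'a \<Rightarrow> real"
  where "pattern_kernel A B r s = (\<lambda>n. if n mod (r + s) < r then A else B)"

lemma steps_pattern_A:
  assumes "finite S" "x \<in> S" "u + j \<le> r"
  shows "steps S (pattern_kernel A B r s) j u f x = mv S (mpow S A j) f x"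
proof -
  have "steps S (pattern_kernel A B r s) j u f = steps S (\<lambda>_. A) j u f"
    using assms(3) by (intro steps_kernel_cong) (simp add: pattern_kernel_def)
  then show ?thesis using steps_const_kernel[OF assms(1,2)] by simp
qed

lemma steps_pattern_B:
  assumes "finite S" "x \<in> S" "u + j \<le> s"
  shows "steps S (pattern_kernel A B r s) j (r + u) f x = mv S (mpow S B j) f x"
proof -
  have "steps S (pattern_kernel A B r s) j (r + u) f = steps S (\<lambda>_. B) j (r + u) f"
    using assms(3) by (intro steps_kernel_cong) (auto simp: pattern_kernel_def)
  then show ?thesis using steps_const_kernel[OF assms(1,2)] by simp
qed

lemma steps_pattern_AB:
  assumes "finite S" "x \<in> S" "u \<le> r" "v \<le> s"
  shows "steps S (pattern_kernel A B r s) (r + v - u) u f x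
    = mv S (mpow S A (r - u)) (mv S (mpow S B v) f) x"
proof -
  have "steps S (pattern_kernel A B r s) (r + v - u) u f x
      = steps S (pattern_kernel A B r s) (r - u) u (steps S (pattern_kernel A B r s) v r f) x"
    using assms(3) steps_add[of S "pattern_kernel A B r s" "r - u" v u f] by simp
  also have "\<dots> = steps S (pattern_kernel A B r s) (r - u) u (mv S (mpow S B v) f) x"
    using assms steps_pattern_B[of S _ 0 v s A B r f] by (intro steps_cong) auto
  finally show ?thesis using assms by (simp add: steps_pattern_A)
qed

lemma sum_lessThan_add:
  fixes g :: "nat \<Rightarrow> 'a :: comm_monoid_add"
  shows "(\<Sum>k<r + s. g k) = (\<Sum>u<r. g u) + (\<Sum>v<s. g (r + v))"
  by (induction s) (simp_all add: add.assoc)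

text \<open>Covariances arise grouped by the earlier game \<open>u\<close>, while
  \<open>pattern_variance\<close> groups them by the later game \<open>v\<close>.\<close>

lemma sum_triangle_swap:
  fixes g :: "nat \<Rightarrow> nat \<Rightarrow> 'a :: comm_monoid_add"
  shows "(\<Sum>v<s. \<Sum>u<v. g u v) = (\<Sum>u<s. \<Sum>v\<in>{Suc u..<s}. g u v)"
  by (simp add: sum.Sigma)
    (rule sum.reindex_bij_witness[where i = "\<lambda>(u, v). (v, u)" and j = "\<lambda>(v, u). (u, v)"], auto)

text \<open>By \<open>fair\<close> the drift vanishes on the phases of \<open>A\<close>, so only
  games \<open>B\<close> occur as the later member of a covariance.\<close>

locale pattern_payoff =
  periodic_payoff S C "pattern_kernel A B r s" "r + s" "mmul S (mpow S A r) (mpow S B s)" \<pi> W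
  for S C :: "'a set" and A B :: "'a \<Rightarrow> 'a \<Rightarrow> real" and r s :: nat and \<pi> W +
  assumes fair: "x \<in> S \<Longrightarrow> mv S (hadamard A W) (\<lambda>_. 1) x = 0"
begin

definition payoff_B :: "'a \<Rightarrow> real"
  where "payoff_B = mv S (hadamard B W) (\<lambda>_. 1)"

text \<open>The mean payoff of the \<open>v\<close>-th game \<open>B\<close> of a period, as a
  function of the state at the start of that period.\<close>

definition ahead :: "nat \<Rightarrow> 'a \<Rightarrow> real"
  where "ahead v = mv S (mpow S A r) (mv S (mpow S B v) payoff_B)"

lemma pattern_kernel_A: "u < r \<Longrightarrow> pattern_kernel A B r s u = A"
  and pattern_kernel_B: "v < s \<Longrightarrow> pattern_kernel A B r s (r + v) = B"
  by (auto simp: pattern_kernel_def)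

lemma E_A: "u \<le> r \<Longrightarrow> E u f = ip S \<pi> (mv S (mpow S A u) f)"
  unfolding E_def by (intro ip_cong) (simp add: steps_pattern_A finite_S)

lemma E_B: "v \<le> s \<Longrightarrow> E (r + v) f = ip S \<pi> (mv S (mpow S A r) (mv S (mpow S B v) f))"
  unfolding E_def
  using steps_pattern_AB[of S _ 0 r v s A B f] by (intro ip_cong) (simp add: finite_S)

lemma drift_A: "u < r \<Longrightarrow> x \<in> S \<Longrightarrow> drift u x = 0"
  by (simp add: drift_def pattern_kernel_A fair)

lemma drift_B: "v < s \<Longrightarrow> drift (r + v) = payoff_B"
  by (simp add: drift_def pattern_kernel_B payoff_B_def)

lemma E_drift_A: "u < r \<Longrightarrow> E u (drift u) = 0"
  using E_cong[of "drift u" "\<lambda>_. 0" u] by (simp add: drift_A E_const)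

lemma E_drift_B: "v < s \<Longrightarrow> E (r + v) (drift (r + v)) = ip S \<pi> (ahead v)"
  by (simp add: drift_B E_B ahead_def)

lemma steps_centred_drift_A:
  assumes "l < r" "x \<in> S"
  shows "steps S (pattern_kernel A B r s) j k (\<lambda>y. drift l y - E l (drift l)) x = 0"
proof -
  have "steps S (pattern_kernel A B r s) j k (\<lambda>y. drift l y - E l (drift l)) x
      = steps S (pattern_kernel A B r s) j k (\<lambda>_. 0) x"
    using assms by (intro steps_cong) (simp_all add: drift_A E_drift_A)
  then show ?thesis using stoch_Q assms(2) by (simp add: steps_const)
qed

lemma steps_centred_drift_B:
  assumes "v < s" "x \<in> S"
  shows "steps S (pattern_kernel A B r s) j k (\<lambda>y. drift (r + v) y - E (r + v) (drift (r + v))) x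
    = steps S (pattern_kernel A B r s) j k payoff_B x - ip S \<pi> (ahead v)"
  unfolding E_drift_B[OF assms(1)] using assms stoch_Q by (simp add: steps_diff drift_B steps_const)

text \<open>As \<open>Z\<close> fixes constants, centring its argument amounts to replacing
  \<open>Z\<close> by \<open>Z - one_row \<pi>\<close>.\<close>

lemma poisson0_eq:
  assumes "x \<in> S"
  shows "poisson0 drift x = (\<Sum>v<s. mv S (Z - one_row \<pi>) (ahead v) x)"
proof -
  have "poisson0 drift x = mv S Z (\<lambda>x. \<Sum>v<s. ahead v x - ip S \<pi> (ahead v)) x"
    unfolding poisson0_def
  proof (rule fun_cong[OF mv_cong])
    fix y assume y: "y \<in> S"
    have "steps S (pattern_kernel A B r s) (r + v) 0 payoff_B y = ahead v y" if "v < s" for v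
      using steps_pattern_AB[of S y 0 r v s A B payoff_B] y that by (simp add: finite_S ahead_def)
    then show "(\<Sum>l<r + s. steps S (pattern_kernel A B r s) l 0 (\<lambda>y. drift l y - E l (drift l)) y)
        = (\<Sum>v<s. ahead v y - ip S \<pi> (ahead v))"
      using y by (simp add: sum_lessThan_add steps_centred_drift_A steps_centred_drift_B)
  qed
  also have "\<dots> = (\<Sum>v<s. mv S Z (ahead v) x - ip S \<pi> (ahead v))"
    using Z_const[OF assms] by (simp add: mv_sum mv_diff)
  finally show ?thesis by (simp add: mv_minus mv_one_row)
qed

text \<open>The first sum collects the games \<open>B\<close> of the current period, the second
  those of all later periods, seen from the end of the current one.\<close>

lemma poisson_A:
  assumes "k \<le> r" "x \<in> S"
  shows "poisson drift k x = (\<Sum>v<s. mv S (mpow S A (r - k)) (mv S (mpow S B v) payoff_B) x - ip S \<pi> (ahead v))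
    + (\<Sum>v<s. mv S (mpow S A (r - k)) (mv S (mpow S B s) (mv S (Z - one_row \<pi>) (ahead v))) x)"
proof -
  have "{k..<r + s} = {k..<r} \<union> {r..<r + s}" using assms(1) by auto
  then have "(\<Sum>l\<in>{k..<r + s}. steps S (pattern_kernel A B r s) (l - k) k (\<lambda>y. drift l y - E l (drift l)) x)
      = (\<Sum>l\<in>{0 + r..<s + r}. steps S (pattern_kernel A B r s) (l - k) k (\<lambda>y. drift l y - E l (drift l)) x)"
    using assms(2) by (simp add: sum.union_disjoint steps_centred_drift_A add.commute)
  also have "\<dots> = (\<Sum>v<s. steps S (pattern_kernel A B r s) (r + v - k) k
      (\<lambda>y. drift (r + v) y - E (r + v) (drift (r + v))) x)"
    unfolding sum.shift_bounds_nat_ivl by (simp add: atLeast0LessThan add.commute)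
  also have "\<dots> = (\<Sum>v<s. mv S (mpow S A (r - k)) (mv S (mpow S B v) payoff_B) x - ip S \<pi> (ahead v))"
    using assms by (intro sum.cong refl) (simp only: lessThan_iff steps_centred_drift_B, simp add: steps_pattern_AB finite_S)
  finally have 1: "(\<Sum>l\<in>{k..<r + s}. steps S (pattern_kernel A B r s) (l - k) k (\<lambda>y. drift l y - E l (drift l)) x)
      = \<dots>" .
  have "steps S (pattern_kernel A B r s) (r + s - k) k (poisson0 drift) x
      = mv S (mpow S A (r - k)) (mv S (mpow S B s) (poisson0 drift)) x"
    using assms by (simp add: steps_pattern_AB finite_S)
  also have "mv S (mpow S B s) (poisson0 drift) = mv S (mpow S B s) (\<lambda>y. \<Sum>v<s. mv S (Z - one_row \<pi>) (ahead v) y)"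
    by (intro mv_cong poisson0_eq)
  finally show ?thesis unfolding poisson_def 1 by (simp add: mv_sum)
qed

lemma poisson_B:
  assumes "u \<le> s" "x \<in> S"
  shows "poisson drift (r + u) x = (\<Sum>v\<in>{u..<s}. mv S (mpow S B (v - u)) payoff_B x - ip S \<pi> (ahead v))
    + (\<Sum>v<s. mv S (mpow S B (s - u)) (mv S (Z - one_row \<pi>) (ahead v)) x)"
proof -
  have "(\<Sum>l\<in>{u + r..<s + r}. steps S (pattern_kernel A B r s) (l - (r + u)) (r + u) (\<lambda>y. drift l y - E l (drift l)) x)
    = (\<Sum>v\<in>{u..<s}. steps S (pattern_kernel A B r s) (v - u) (r + u)
      (\<lambda>y. drift (r + v) y - E (r + v) (drift (r + v))) x)"
    unfolding sum.shift_bounds_nat_ivl by (simp add: add.commute)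
  also have "\<dots> = (\<Sum>v\<in>{u..<s}. mv S (mpow S B (v - u)) payoff_B x - ip S \<pi> (ahead v))"
    using assms by (intro sum.cong refl) (simp only: atLeastLessThan_iff steps_centred_drift_B, simp add: steps_pattern_B finite_S)
  finally have 1: "(\<Sum>l\<in>{u + r..<s + r}. steps S (pattern_kernel A B r s) (l - (r + u)) (r + u) (\<lambda>y. drift l y - E l (drift l)) x)
    = \<dots>" .
  have "steps S (pattern_kernel A B r s) (r + s - (r + u)) (r + u) (poisson0 drift) x
      = mv S (mpow S B (s - u)) (poisson0 drift) x"
    using assms by (simp add: steps_pattern_B finite_S)
  also have "mv S (mpow S B (s - u)) (poisson0 drift)
      = mv S (mpow S B (s - u)) (\<lambda>y. \<Sum>v<s. mv S (Z - one_row \<pi>) (ahead v) y)"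
    by (intro mv_cong poisson0_eq)
  finally show ?thesis
    using 1 by (simp add: poisson_def mv_sum add.commute)
qed

section \<open>Identification of the mean and variance formulas\<close>

lemma pattern_mean_eq:
  "pattern_mean S A B W \<pi> r s = (\<Sum>k<r + s. E k (drift k)) / real (r + s)"
  by (simp add: pattern_mean_def Let_def row_mat_one_eq mv_mmul sum_lessThan_add E_drift_A E_drift_B
      ahead_def payoff_B_def)

text \<open>Payoff of the \<open>u\<close>-th game \<open>A\<close> against the corrector after it:
  the first sum is the covariance within the period, the second that with later periods.\<close>

lemma covariance_A:
  assumes "u < r"
  shows "E u (mv S (hadamard A W) (poisson drift (Suc u)))
    = (\<Sum>v<s. ip S \<pi> (mv S (mpow S A u) (mv S (hadamard A W)
        (\<lambda>x. mv S (mpow S A (r - u - 1)) (mv S (mpow S B v) payoff_B) x - ip S \<pi> (ahead v)))))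
    + (\<Sum>v<s. ip S \<pi> (mv S (mpow S A u) (mv S (hadamard A W)
        (mv S (mpow S A (r - u - 1)) (mv S (mpow S B s) (mv S (Z - one_row \<pi>) (ahead v)))))))"
proof -
  have "mv S (hadamard A W) (poisson drift (Suc u)) = mv S (hadamard A W) (\<lambda>x.
    (\<Sum>v<s. mv S (mpow S A (r - u - 1)) (mv S (mpow S B v) payoff_B) x - ip S \<pi> (ahead v))
    + (\<Sum>v<s. mv S (mpow S A (r - u - 1)) (mv S (mpow S B s) (mv S (Z - one_row \<pi>) (ahead v))) x))"
    using assms by (intro mv_cong) (simp add: poisson_A)
  then show ?thesis
    using assms by (simp only: E_A less_imp_le mv_add mv_sum ip_add ip_sum)
qed

lemma covariance_B:
  assumes "u < s"
  shows "E (r + u) (mv S (hadamard B W) (poisson drift (Suc (r + u))))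
    = (\<Sum>v\<in>{Suc u..<s}. ip S \<pi> (mv S (mpow S A r) (mv S (mpow S B u) (mv S (hadamard B W)
        (\<lambda>x. mv S (mpow S B (v - u - 1)) payoff_B x - ip S \<pi> (ahead v))))))
    + (\<Sum>v<s. ip S \<pi> (mv S (mpow S A r) (mv S (mpow S B u) (mv S (hadamard B W)
        (mv S (mpow S B (s - u - 1)) (mv S (Z - one_row \<pi>) (ahead v)))))))"
proof -
  have "mv S (hadamard B W) (poisson drift (Suc (r + u))) = mv S (hadamard B W) (\<lambda>x.
    (\<Sum>v\<in>{Suc u..<s}. mv S (mpow S B (v - u - 1)) payoff_B x - ip S \<pi> (ahead v))
    + (\<Sum>v<s. mv S (mpow S B (s - u - 1)) (mv S (Z - one_row \<pi>) (ahead v)) x))"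
    using assms by (intro mv_cong) (subst add_Suc_right[symmetric], subst poisson_B, auto)
  then show ?thesis
    using assms by (simp only: E_B less_imp_le mv_add mv_sum ip_add ip_sum)
qed

text \<open>Two splittings give the four double sums: the earlier game is \<open>A\<close>
  (\<open>?T1\<close>, \<open>?T3\<close>) or \<open>B\<close> (\<open>?T2\<close>,
  \<open>?T4\<close>), and the later \<open>B\<close> lies in the same period (\<open>?T1\<close>,
  \<open>?T2\<close>) or beyond it (\<open>?T3\<close>, \<open>?T4\<close>).\<close>

lemma pattern_variance_eq:
  assumes "\<And>x y. x \<in> S \<Longrightarrow> y \<in> S \<Longrightarrow> A x y * (W x y)\<^sup>2 = A x y"
    and "\<And>x y. x \<in> S \<Longrightarrow> y \<in> S \<Longrightarrow> B x y * (W x y)\<^sup>2 = B x y"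
  shows "pattern_variance S A B W \<pi> r s = (\<Sum>k<r + s. E k (increment_var k)) / real (r + s)"
proof -
  let ?T1 = "\<Sum>u<r. \<Sum>v<s. ip S \<pi> (mv S (mpow S A u) (mv S (hadamard A W)
        (\<lambda>x. mv S (mpow S A (r - u - 1)) (mv S (mpow S B v) payoff_B) x - ip S \<pi> (ahead v))))"
  let ?T2 = "\<Sum>u<s. \<Sum>v\<in>{Suc u..<s}. ip S \<pi> (mv S (mpow S A r) (mv S (mpow S B u) (mv S (hadamard B W)
        (\<lambda>x. mv S (mpow S B (v - u - 1)) payoff_B x - ip S \<pi> (ahead v)))))"
  let ?T3 = "\<Sum>u<r. \<Sum>v<s. ip S \<pi> (mv S (mpow S A u) (mv S (hadamard A W)
        (mv S (mpow S A (r - u - 1)) (mv S (mpow S B s) (mv S (Z - one_row \<pi>) (ahead v))))))"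
  let ?T4 = "\<Sum>u<s. \<Sum>v<s. ip S \<pi> (mv S (mpow S A r) (mv S (mpow S B u) (mv S (hadamard B W)
        (mv S (mpow S B (s - u - 1)) (mv S (Z - one_row \<pi>) (ahead v))))))"
  have T: "real (r + s) \<noteq> 0" using T_pos by (simp only: of_nat_eq_0_iff not_gr_zero[symmetric] not_not)
  have "pattern_kernel A B r s k x y * (W x y)\<^sup>2 = pattern_kernel A B r s k x y"
    if "x \<in> S" "y \<in> S" for k x y
    using assms[OF that] by (simp add: pattern_kernel_def)
  then have "(\<Sum>k<r + s. E k (increment_var k)) = real (r + s) - (\<Sum>k<r + s. (E k (drift k))\<^sup>2)
    + 2 * (\<Sum>k<r + s. E k (mv S (hadamard (pattern_kernel A B r s k) W) (poisson drift (Suc k))))"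
    by (intro sum_increment_var)
  also have "(\<Sum>k<r + s. (E k (drift k))\<^sup>2) = (\<Sum>v<s. (ip S \<pi> (ahead v))\<^sup>2)"
    by (simp add: sum_lessThan_add E_drift_A E_drift_B)
  also have "(\<Sum>k<r + s. E k (mv S (hadamard (pattern_kernel A B r s k) W) (poisson drift (Suc k))))
      = (\<Sum>u<r. E u (mv S (hadamard A W) (poisson drift (Suc u))))
      + (\<Sum>u<s. E (r + u) (mv S (hadamard B W) (poisson drift (Suc (r + u)))))"
    by (simp add: sum_lessThan_add pattern_kernel_A pattern_kernel_B)
  also have "\<dots> = (?T1 + ?T3) + (?T2 + ?T4)"
    by (simp add: covariance_A covariance_B sum.distrib)
  finally have sum: "(\<Sum>k<r + s. E k (increment_var k)) = real (r + s) - (\<Sum>v<s. (ip S \<pi> (ahead v))\<^sup>2)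
    + 2 * (?T1 + ?T2 + ?T3 + ?T4)" by simp
  \<comment> \<open>As an operator, the product starting with \<open>one_row \<pi>\<close> yields
    the constant \<open>ip S \<pi> (ahead v)\<close>; with that the definition unfolds to the four
    sums literally.\<close>
  have "pattern_variance S A B W \<pi> r s = 1 - 1 / real (r + s) * (\<Sum>v<s. (ip S \<pi> (ahead v))\<^sup>2)
    + 2 / real (r + s) * (?T1 + ?T2 + ?T3 + ?T4)"
    unfolding pattern_variance_def Let_def Z_def[symmetric] row_mat_one_eq
      mv_mmul mv_minus mv_one_row payoff_B_def[symmetric] ahead_def[symmetric] sum_triangle_swap ..
  then show ?thesis
    unfolding sum using T by (simp add: add_divide_distrib diff_divide_distrib)
qed

end

section \<open>The spatial game\<close>

text \<open>The play at one chosen site: a win sets its entry to 1, a loss to 0, and the outcome is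
  recorded. \<open>P_B\<close> averages this over a uniformly chosen site.\<close>

definition site_kernel :: "nat \<Rightarrow> nat \<Rightarrow> (nat \<Rightarrow> real) \<Rightarrow> array \<Rightarrow> nat \<times> nat \<Rightarrow> state \<Rightarrow> real"
  where "site_kernel M N p x ij z =
    (if x ij = 0
     then (if z = (flip x ij, 1) then p (nbr_sum M N x ij) else 0)
        + (if z = (x, -1) then 1 - p (nbr_sum M N x ij) else 0)
     else (if z = (x, 1) then p (nbr_sum M N x ij) else 0)
        + (if z = (flip x ij, -1) then 1 - p (nbr_sum M N x ij) else 0))"

lemma finite_grid: "finite (grid M N)"
  by (simp add: grid_def)

lemma finite_state_space: "finite (states M N)"
  by (auto simp: states_def arrays_def finite_grid intro!: finite_PiE)

lemma array_cases: "x \<in> arrays M N \<Longrightarrow> ij \<in> grid M N \<Longrightarrow> x ij = 0 \<or> x ij = 1"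
  using PiE_mem[of x "grid M N" "\<lambda>_. {0, 1}" ij] by (simp add: arrays_def)

lemma flip_in_arrays:
  assumes "x \<in> arrays M N" "ij \<in> grid M N"
  shows "flip x ij \<in> arrays M N"
proof -
  have "x(ij := 1 - x ij) \<in> insert ij (grid M N) \<rightarrow>\<^sub>E {0, 1}"
    using assms array_cases[OF assms] by (intro PiE_fun_upd) (auto simp: arrays_def)
  then show ?thesis
    using assms(2) by (simp add: flip_def arrays_def insert_absorb)
qed

lemma nbr_sum_le_4:
  assumes "x \<in> arrays M N" "ij \<in> grid M N"
  shows "nbr_sum M N x ij \<le> 4"
proof -
  obtain i j where ij: "ij = (i, j)" "i \<in> {1..M}" "j \<in> {1..N}"
    using assms(2) by (auto simp: grid_def)
  have le: "x kl \<le> 1" if "kl \<in> grid M N" for kl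
    using array_cases[OF assms(1) that] by auto
  have "(cyc_suc M i, j) \<in> grid M N" "(cyc_pred M i, j) \<in> grid M N"
    "(i, cyc_suc N j) \<in> grid M N" "(i, cyc_pred N j) \<in> grid M N"
    using ij by (auto simp: grid_def cyc_suc_def cyc_pred_def)
  from this[THEN le] show ?thesis by (simp add: ij nbr_sum_def)
qed

text \<open>\<open>t\<close> is confined to the two outcomes because on the diagonal
  \<open>P_B\<close> reads every \<open>t\<close> other than 1 as a loss.\<close>

lemma P_B_eq_site_kernel:
  assumes x: "x \<in> arrays M N" and t: "t \<in> {-1, 1}"
  shows "P_B M N p (x, s) (y, t) = (\<Sum>ij\<in>grid M N. site_kernel M N p x ij (y, t)) / real (M * N)"
proof (cases "y = x")
  case True
  have ne: "x \<noteq> flip x ij" for ij using flip_ne by metis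
  have "(\<Sum>ij | ij \<in> grid M N \<and> x ij = 1. p (nbr_sum M N x ij)) = (\<Sum>ij\<in>grid M N. site_kernel M N p x ij (x, 1))"
    "(\<Sum>ij | ij \<in> grid M N \<and> x ij = 0. 1 - p (nbr_sum M N x ij)) = (\<Sum>ij\<in>grid M N. site_kernel M N p x ij (x, -1))"
    unfolding sum.inter_filter[OF finite_grid]
    by (intro sum.cong refl; insert array_cases[OF x], force simp: site_kernel_def ne)+
  then show ?thesis using t True by (auto simp: P_B_def)
next
  case False
  have "(\<Sum>ij | ij \<in> grid M N \<and> y = flip x ij.
      if x ij = 0 \<and> t = 1 then p (nbr_sum M N x ij)
      else if x ij = 1 \<and> t = -1 then 1 - p (nbr_sum M N x ij) else 0)
    = (\<Sum>ij\<in>grid M N. site_kernel M N p x ij (y, t))"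
    unfolding sum.inter_filter[OF finite_grid]
    by (intro sum.cong refl; insert array_cases[OF x] t False, force simp: site_kernel_def)
  then show ?thesis using False by (simp add: P_B_def)
qed

text \<open>Reduces a row sum over the state space to two terms per site; \<open>g = 1\<close> gives
  stochasticity, and \<open>g\<close> a row of payoffs gives fairness.\<close>

lemma P_B_sum:
  assumes x: "x \<in> arrays M N"
  shows "(\<Sum>z\<in>states M N. P_B M N p (x, s) z * g z) = (\<Sum>ij\<in>grid M N.
    if x ij = 0 then p (nbr_sum M N x ij) * g (flip x ij, 1) + (1 - p (nbr_sum M N x ij)) * g (x, -1)
    else p (nbr_sum M N x ij) * g (x, 1) + (1 - p (nbr_sum M N x ij)) * g (flip x ij, -1)) / real (M * N)"
proof -
  have "(\<Sum>z\<in>states M N. P_B M N p (x, s) z * g z)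
      = (\<Sum>z\<in>states M N. (\<Sum>ij\<in>grid M N. site_kernel M N p x ij z * g z) / real (M * N))"
    using P_B_eq_site_kernel[OF x]
    by (intro sum.cong refl) (auto simp: states_def sum_distrib_right)
  also have "\<dots> = (\<Sum>ij\<in>grid M N. \<Sum>z\<in>states M N. site_kernel M N p x ij z * g z) / real (M * N)"
    unfolding sum_divide_distrib[symmetric] by (subst sum.swap) (rule refl)
  also have "(\<Sum>ij\<in>grid M N. \<Sum>z\<in>states M N. site_kernel M N p x ij z * g z) = (\<Sum>ij\<in>grid M N.
    if x ij = 0 then p (nbr_sum M N x ij) * g (flip x ij, 1) + (1 - p (nbr_sum M N x ij)) * g (x, -1)
    else p (nbr_sum M N x ij) * g (x, 1) + (1 - p (nbr_sum M N x ij)) * g (flip x ij, -1))"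
  proof (intro sum.cong refl)
    fix ij assume ij: "ij \<in> grid M N"
    have pick: "(\<Sum>z\<in>states M N. (if z = a then c else 0) * g z) = c * g a" if "a \<in> states M N" for a c
      using that by (simp add: finite_state_space if_distrib[of "\<lambda>c. c * _"] cong: if_cong)
    have "(x, t) \<in> states M N" "(flip x ij, t) \<in> states M N" if "t \<in> {-1, 1}" for t
      using x ij that flip_in_arrays by (auto simp: states_def)
    then show "(\<Sum>z\<in>states M N. site_kernel M N p x ij z * g z) =
      (if x ij = 0 then p (nbr_sum M N x ij) * g (flip x ij, 1) + (1 - p (nbr_sum M N x ij)) * g (x, -1)
      else p (nbr_sum M N x ij) * g (x, 1) + (1 - p (nbr_sum M N x ij)) * g (flip x ij, -1))"
      by (cases "x ij = 0") (simp_all add: site_kernel_def distrib_right sum.distrib pick)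
  qed
  finally show ?thesis .
qed

section \<open>Properties of the transition and payoff matrices\<close>

lemma stoch_P_B:
  assumes MN: "1 \<le> M" "1 \<le> N" and p: "\<And>m. m \<le> 4 \<Longrightarrow> 0 \<le> p m \<and> p m \<le> 1"
  shows "stoch (states M N) (P_B M N p)"
  unfolding stoch_def
proof (intro ballI conjI)
  fix z assume "z \<in> states M N"
  then obtain x s where z: "z = (x, s)" and x: "x \<in> arrays M N" by (auto simp: states_def)
  have nonneg: "0 \<le> site_kernel M N p x ij w" if "ij \<in> grid M N" for ij w
    using p[OF nbr_sum_le_4[OF x that]] by (simp add: site_kernel_def)
  show "0 \<le> P_B M N p z w" if "w \<in> states M N" for w
    using that P_B_eq_site_kernel[OF x] nonneg
    by (auto simp: z states_def intro!: divide_nonneg_nonneg sum_nonneg)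
  have "card (grid M N) = M * N" by (simp add: grid_def)
  then show "(\<Sum>w\<in>states M N. P_B M N p z w) = 1"
    using P_B_sum[OF x, of p s "\<lambda>_. 1"] MN by (simp add: z)
qed

text \<open>Every outcome of a play at a site is paid 1 or -1; payoff 0 occurs only where the
  transition weight is 0.\<close>

lemma payoff_sq_P_B:
  assumes "z \<in> states M N" "w \<in> states M N"
  shows "P_B M N p z w * (payoff M N z w)\<^sup>2 = P_B M N p z w"
proof -
  obtain x s y t where zw: "z = (x, s)" "w = (y, t)" "x \<in> arrays M N" "t \<in> {-1, 1}"
    using assms by (auto simp: states_def)
  have "site_kernel M N p x ij w * (payoff M N z w)\<^sup>2 = site_kernel M N p x ij w" if ij: "ij \<in> grid M N" for ij
    using array_cases[OF zw(3) ij] ij by (auto simp: site_kernel_def payoff_def zw(1,2))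
  then have "(\<Sum>ij\<in>grid M N. site_kernel M N p x ij w) * (payoff M N z w)\<^sup>2 = (\<Sum>ij\<in>grid M N. site_kernel M N p x ij w)"
    unfolding sum_distrib_right by (intro sum.cong refl)
  then show ?thesis
    unfolding zw(1,2) P_B_eq_site_kernel[OF zw(3,4)] by (simp only: times_divide_eq_left)
qed

text \<open>At each site a win and a loss are equally likely and paid 1 and -1.\<close>

lemma P_A_fair:
  assumes "z \<in> states M N"
  shows "mv (states M N) (hadamard (P_A M N) (payoff M N)) (\<lambda>_. 1) z = 0"
proof -
  obtain x s where z: "z = (x, s)" "x \<in> arrays M N" using assms by (auto simp: states_def)
  have "(\<Sum>w\<in>states M N. P_A M N z w * payoff M N z w) = (\<Sum>ij\<in>grid M N. 0) / real (M * N)"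
    unfolding P_A_def z(1) P_B_sum[OF z(2)]
    using array_cases[OF z(2)]
    by (intro arg_cong2[where f = "(/)"] sum.cong refl) (auto simp: payoff_def)
  then show ?thesis by (simp add: mv_def hadamard_def)
qed

text \<open>The site just played carries 1 after a win and 0 after a loss, which contradicts either
  excluded state.\<close>

lemma P_B_inaccessible:
  assumes "z \<in> states M N" "w \<in> states M N - accessible M N"
  shows "P_B M N p z w = 0"
proof -
  obtain x s where z: "z = (x, s)" "x \<in> arrays M N" using assms(1) by (auto simp: states_def)
  have w: "w = (const_array M N 0, 1) \<or> w = (const_array M N 1, -1)"
    using assms(2) by (auto simp: accessible_def)
  have "site_kernel M N p x ij w = 0" if ij: "ij \<in> grid M N" for ij
  proof -
    have "flip x ij ij = 1 - x ij" by (simp add: flip_def)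
    then have "x ij = 0 \<Longrightarrow> flip x ij \<noteq> const_array M N 0" "x ij = 1 \<Longrightarrow> flip x ij \<noteq> const_array M N 1"
      using ij by (auto simp: const_array_def)
    then show ?thesis
      using w array_cases[OF z(2) ij] ij by (auto simp: site_kernel_def const_array_def)
  qed
  then have "(\<Sum>ij\<in>grid M N. site_kernel M N p x ij w) = 0"
    by (intro sum.neutral ballI)
  then show ?thesis
    using P_B_eq_site_kernel[OF z(2), of "snd w" p s "fst w"] w by (auto simp: z(1))
qed

text \<open>\<open>mpow\<close> adds factors on the left, so a zero column of the last factor
  persists; the power 0 is excluded since \<open>idmat\<close> has no zero column on
  \<open>S\<close>.\<close>

lemma mpow_zero_column:
  assumes "finite S" "y \<in> S" "1 \<le> k" "\<And>x. x \<in> S \<Longrightarrow> B x y = 0" "x \<in> S"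
  shows "mpow S B k x y = 0"
  using assms(3,5)
proof (induction k arbitrary: x rule: dec_induct)
  case base
  then show ?case using assms(1,2,4) by (auto simp: mmul_def idmat_def intro!: sum.neutral)
next
  case (step k)
  then show ?case unfolding mpow.simps(2) by (simp add: mmul_def)
qed

theorem theorem3:
  fixes M N r s :: nat
    and p :: "nat \<Rightarrow> real"
    and \<pi> :: "state \<Rightarrow> real"
    and \<Omega> :: "'w measure"
    and X :: "nat \<Rightarrow> 'w \<Rightarrow> state"
    and PA PB P W :: "state \<Rightarrow> state \<Rightarrow> real"
    and \<mu> \<sigma>2 :: real
    and \<xi> S :: "nat \<Rightarrow> 'w \<Rightarrow> real"
  defines "PA \<equiv> P_A M N"
    and "PB \<equiv> P_B M N p"
    and "W \<equiv> payoff M N"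
    and "P \<equiv> mmul (states M N) (mpow (states M N) PA r) (mpow (states M N) PB s)"
    and "\<mu> \<equiv> pattern_mean (states M N) PA PB W \<pi> r s"
    and "\<sigma>2 \<equiv> pattern_variance (states M N) PA PB W \<pi> r s"
    and "\<xi> \<equiv> (\<lambda>n \<omega>. W (X (n - 1) \<omega>) (X n \<omega>))"
    and "S \<equiv> (\<lambda>n \<omega>. \<Sum>k=1..n. \<xi> k \<omega>)"
  assumes "M \<ge> 3" and "N \<ge> 3"
    and "\<And>m. m \<le> 4 \<Longrightarrow> 0 \<le> p m \<and> p m \<le> 1"
    and "r \<ge> 1" and "s \<ge> 1"
    and "ergodic_mat (accessible M N) P"
    and "\<And>k. k < r + s \<Longrightarrow>
      ergodic_mat (accessible M N)
        (mprod (states M N) (rotate k (replicate r PA @ replicate s PB)))"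
    and "stationary_dist (states M N) P \<pi>"
    and "markov_chain (states M N) \<Omega> (\<lambda>n. if n mod (r + s) < r then PA else PB) X"
  shows "(AE \<omega> in \<Omega>. (\<lambda>n. S n \<omega> / real n) \<longlonglongrightarrow> \<mu>) \<and>
    (\<sigma>2 > 0 \<longrightarrow>
      weak_conv_m
        (\<lambda>n. distr \<Omega> borel (\<lambda>\<omega>. (S n \<omega> - real n * \<mu>) / sqrt (real n * \<sigma>2)))
        std_normal_distribution)"
proof -
  let ?S = "states M N" and ?C = "accessible M N"
  have MN: "1 \<le> M" "1 \<le> N" using \<open>M \<ge> 3\<close> \<open>N \<ge> 3\<close> by auto
  have stA: "stoch ?S PA" unfolding PA_def P_A_def by (rule stoch_P_B[OF MN]) simp
  have stB: "stoch ?S PB" unfolding PB_def by (rule stoch_P_B[OF MN]) (rule assms)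
  have S_ne: "?S \<noteq> {}"
    by (auto simp: states_def arrays_def PiE_eq_empty_iff)
  have payoff_sq: "PA z w * (W z w)\<^sup>2 = PA z w" "PB z w * (W z w)\<^sup>2 = PB z w" if "z \<in> ?S" "w \<in> ?S" for z w
    unfolding PA_def P_A_def PB_def W_def by (rule payoff_sq_P_B[OF that])+
  interpret pattern_payoff ?S ?C PA PB r s \<pi> W
  proof
    show "finite ?S" by (rule finite_state_space)
    show "?S \<noteq> {}" by (rule S_ne)
    show "?C \<subseteq> ?S" by (auto simp: accessible_def)
    show "0 < r + s" using \<open>r \<ge> 1\<close> by simp
    show "pattern_kernel PA PB r s (k mod (r + s)) = pattern_kernel PA PB r s k" for k
      by (simp add: pattern_kernel_def)
    show "stoch ?S (pattern_kernel PA PB r s k)" for k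
      using stA stB by (simp add: pattern_kernel_def)
    show "stoch ?S (mmul ?S (mpow ?S PA r) (mpow ?S PB s))"
      by (intro stoch_mmul stoch_mpow finite_state_space stA stB)
    show "mv ?S (mmul ?S (mpow ?S PA r) (mpow ?S PB s)) f x = steps ?S (pattern_kernel PA PB r s) (r + s) 0 f x"
      if "x \<in> ?S" for x f
      using steps_pattern_AB[of ?S x 0 r s s PA PB f] that by (simp add: finite_state_space mv_mmul)
    show "mmul ?S (mpow ?S PA r) (mpow ?S PB s) x y = 0" if "x \<in> ?S" "y \<in> ?S - ?C" for x y
    proof -
      \<comment> \<open>A period ends with a game \<open>B\<close> because \<open>s \<ge> 1\<close>,
        and no such game enters an inaccessible state.\<close>
      have "mpow ?S PB s z y = 0" if "z \<in> ?S" for z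
        using that \<open>y \<in> ?S - ?C\<close> \<open>s \<ge> 1\<close> finite_state_space P_B_inaccessible unfolding PB_def
        by (intro mpow_zero_column) auto
      then show ?thesis by (simp add: mmul_def)
    qed
    show "irreducible_mat ?C (mmul ?S (mpow ?S PA r) (mpow ?S PB s))"
      using \<open>ergodic_mat ?C P\<close> by (simp add: ergodic_mat_def P_def)
    show "stationary_dist ?S (mmul ?S (mpow ?S PA r) (mpow ?S PB s)) \<pi>"
      using \<open>stationary_dist ?S P \<pi>\<close> by (simp add: P_def)
    show "mv ?S (hadamard PA W) (\<lambda>_. 1) x = 0" if "x \<in> ?S" for x
      unfolding PA_def W_def by (rule P_A_fair[OF that])
  qed
  interpret periodic_chain ?S ?C "pattern_kernel PA PB r s" "r + s"
    "mmul ?S (mpow ?S PA r) (mpow ?S PB s)" \<pi> W \<Omega> X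
  proof (intro periodic_chain.intro finite_markov_chain.intro)
    show "markov_chain ?S \<Omega> (pattern_kernel PA PB r s) X"
      unfolding pattern_kernel_def
      by (rule \<open>markov_chain ?S \<Omega> (\<lambda>n. if n mod (r + s) < r then PA else PB) X\<close>)
  qed (rule periodic_payoff_axioms finite_state_space)+
  have \<mu>: "\<mu> = mean"
    by (simp add: \<mu>_def pattern_mean_eq mean_def)
  have \<sigma>2: "\<sigma>2 = asymptotic_variance"
    unfolding \<sigma>2_def asymptotic_variance_def using payoff_sq by (rule pattern_variance_eq)
  \<comment> \<open>\<open>\<xi>\<close> is indexed by the time after the step, the locales by the
    time before it.\<close>
  have S: "S n \<omega> = (\<Sum>k<n. W (X k \<omega>) (X (Suc k) \<omega>))" for n \<omega>
    unfolding S_def \<xi>_def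
    by (rule sum.reindex_bij_witness[where i = Suc and j = "\<lambda>k. k - 1"]) auto
  show ?thesis
    unfolding S \<mu> \<sigma>2 by (intro conjI impI payoff_slln payoff_clt)
qed

end
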